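(* Let $K\subset\mathbb{C}$ be an imaginary quadratic field with ring of integers $\mathcal{O}_K$. For all real $H>1$, $$ H \ll \mu_2(H;\mathcal{O}_K) \ll H . $$ Moreover, for every integer $n \ge 3$ there exists a number $C_0(n)$, effectively computable in terms of $n$, such that for all real $H\ge 3$, $$ \frac{H}{(\log H)^{C_0(n)}} \ll \mu_n(H;\mathcal{O}_K) \ll H\, \frac {\log\log H}{(\log H)^{1/2}} . $$ Here the implied constants are positive and depend at most on $n$ and $K$.
   Context: A vector $\mathbf{v}=(v_1,\dots,v_n)\in\mathbb{C}^n$ is multiplicatively dependent if all its coordinates are non-zero and there is a non-zero integer vector $(k_1,\dots,k_n)\in\mathbb{Z}^n$ with $v_1^{k_1}\cdots v_n^{k_n}=1$. $\mathcal{M}_n(\mathcal{O}_K)$ denotes the set of multiplicatively dependent vectors all of whose coordinates lie in $\mathcal{O}_K$. For $H>1$ and $K$ an imaginary quadratic field, $$ \mu_n(H;\mathcal{O}_K) = \sup_{\substack{\mathbf{x} \in \mathbb{C}^n\\ \|\mathbf{x}\| \le H}}\ \inf_{\mathbf{v} \in \mathcal{M}_n(\mathcal{O}_K)} \|\mathbf{x} - \mathbf{v}\|, $$ where $\|\mathbf{z}\| = \sqrt{|z_1|^2+\cdots+|z_n|^2}$ for $\mathbf{z}=(z_1,\dots,z_n)\in\mathbb{C}^n$. $U\ll V$ means $|U|\le cV$ for some positive constant $c$ (the implied constant). *)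

theory Defs
  imports
    "HOL-Analysis.Analysis"
    "HOL-Computational_Algebra.Computational_Algebra"
begin

definition complex_subfield :: "complex set \<Rightarrow> bool" where
  "complex_subfield K \<longleftrightarrow> 0 \<in> K \<and> 1 \<in> K \<and>
     (\<forall>x\<in>K. \<forall>y\<in>K. x + y \<in> K \<and> x * y \<in> K) \<and>
     (\<forall>x\<in>K. - x \<in> K \<and> inverse x \<in> K)"

text \<open>The dimension \<^term>\<open>vector_space.dim\<close> is 0 for infinite-dimensional spaces, so
  the value 2 does express that \<^term>\<open>K\<close> has degree 2 over the rationals.\<close>

definition imaginary_quadratic_field :: "complex set \<Rightarrow> bool" where
  "imaginary_quadratic_field K \<longleftrightarrow> complex_subfield K \<and>
     vector_space.dim (\<lambda>(q::rat) (z::complex). of_rat q * z) K = 2 \<and> \<not> K \<subseteq> \<real>"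

definition ring_of_integers :: "complex set \<Rightarrow> complex set" where
  "ring_of_integers K = {z \<in> K. algebraic_int z}"

text \<open>Vectors are functions on the index set \<open>{..<n}\<close>, extended by \<^term>\<open>undefined\<close>
  outside it.\<close>

definition cspace :: "nat \<Rightarrow> (nat \<Rightarrow> complex) set" where
  "cspace n = {..<n} \<rightarrow>\<^sub>E UNIV"

definition cnorm :: "nat \<Rightarrow> (nat \<Rightarrow> complex) \<Rightarrow> real" where
  "cnorm n z = L2_set (\<lambda>i. norm (z i)) {..<n}"

definition mult_dependent :: "nat \<Rightarrow> (nat \<Rightarrow> complex) \<Rightarrow> bool" where
  "mult_dependent n v \<longleftrightarrow> (\<forall>i<n. v i \<noteq> 0) \<and>
     (\<exists>k :: nat \<Rightarrow> int. (\<exists>i<n. k i \<noteq> 0) \<and> (\<Prod>i<n. v i powi k i) = 1)"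

definition mult_dep_vectors :: "nat \<Rightarrow> complex set \<Rightarrow> (nat \<Rightarrow> complex) set" where
  "mult_dep_vectors n R = {v \<in> cspace n. mult_dependent n v \<and> (\<forall>i<n. v i \<in> R)}"

text \<open>For \<open>n \<ge> 1\<close> and \<open>1 \<in> R\<close> the all-ones vector is multiplicatively dependent, so the
  infimum is over a nonempty set and is at most \<open>H + sqrt n\<close>; hence the real-valued
  supremum and infimum are the genuine ones.\<close>

definition mu :: "nat \<Rightarrow> real \<Rightarrow> complex set \<Rightarrow> real" where
  "mu n H R = (SUP x \<in> {x \<in> cspace n. cnorm n x \<le> H}.
                 INF v \<in> mult_dep_vectors n R. cnorm n (\<lambda>i. x i - v i))"

text \<open>\<open>recursive_fn m f\<close>: on argument lists of length \<open>m\<close>, \<open>f\<close> is a total \<open>m\<close>-ary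
  recursive function (Kleene). Minimisation is applied only where a zero exists
  for all arguments. Values on lists of another length carry no meaning.\<close>

inductive recursive_fn :: "nat \<Rightarrow> (nat list \<Rightarrow> nat) \<Rightarrow> bool" where
  zero: "recursive_fn m (\<lambda>xs. 0)"
| succ: "recursive_fn 1 (\<lambda>xs. Suc (xs ! 0))"
| proj: "i < m \<Longrightarrow> recursive_fn m (\<lambda>xs. xs ! i)"
| comp: "recursive_fn (length gs) f \<Longrightarrow> \<forall>g\<in>set gs. recursive_fn m g \<Longrightarrow>
           recursive_fn m (\<lambda>xs. f (map (\<lambda>g. g xs) gs))"
| prec: "recursive_fn m f \<Longrightarrow> recursive_fn (Suc (Suc m)) g \<Longrightarrow>
           recursive_fn (Suc m)
             (\<lambda>xs. rec_nat (f (tl xs)) (\<lambda>k r. g (k # r # tl xs)) (hd xs))"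
| minim: "recursive_fn (Suc m) f \<Longrightarrow> \<forall>xs. length xs = m \<longrightarrow> (\<exists>k. f (k # xs) = 0) \<Longrightarrow>
           recursive_fn m (\<lambda>xs. LEAST k. f (k # xs) = 0)"

text \<open>A computable sequence of real numbers: dyadic approximations to \<open>C n\<close> within
  \<open>1 / 2 ^ k\<close> are computed uniformly from \<open>n\<close> and \<open>k\<close>. The difference
  \<open>p - q\<close> only serves to admit integer numerators of either sign.\<close>

definition computable_real_seq :: "(nat \<Rightarrow> real) \<Rightarrow> bool" where
  "computable_real_seq C \<longleftrightarrow> (\<exists>p q. recursive_fn 2 p \<and> recursive_fn 2 q \<and>
     (\<forall>n k. \<bar>C n - (real (p [n, k]) - real (q [n, k])) / 2 ^ k\<bar> \<le> 1 / 2 ^ k))"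

end

theory Submission
  imports Defs
begin

text \<open>Absolute values of integers of \<open>K\<close> are square roots of natural numbers, and a
  multiplicative relation between vectors gives one between these norms.

  Lower bounds: near \<open>(4/5 H, 3/5 H)\<close> two norms would have a ratio strictly between 1 and 2,
  which is impossible for dependent natural numbers. For general \<open>n\<close>, elimination on the
  exponents of primes yields a relation with exponents bounded by a power \<open>B\<close> of \<open>log H\<close>, and a
  point whose logarithmic coordinates are \<open>log H\<close> minus suitable powers of a base larger than
  \<open>B\<close> stays away from all such relations.

  Upper bound for \<open>n \<ge> 3\<close>: three monomials \<open>a ^ s\<close>, \<open>b ^ t\<close>, \<open>a ^ p * b ^ q\<close> are always dependent.
  Take \<open>t\<close> of order \<open>(log H) powr (3/4)\<close>, \<open>s = t - 1\<close>, and let \<open>a\<close>, \<open>b\<close> be nearest lattice points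
  to roots of two given coordinates; these roots are larger than every power of \<open>log H\<close>, so that
  rounding is harmless, while \<open>p + q = s\<close> and the branch of the root leave enough freedom to
  hit the third coordinate with relative error of order \<open>(log H) powr (-1/2)\<close>.\<close>

section \<open>Integers of imaginary quadratic fields\<close>

lemma rat_vector_space: "vector_space (\<lambda>(q::rat) (z::complex). of_rat q * z)"
  by unfold_locales (auto simp: of_rat_add of_rat_mult algebra_simps)

text \<open>Three vectors of a two-dimensional rational space are linearly dependent, and clearing
  denominators makes the coefficients integral.\<close>

lemma imaginary_quadratic_int_relation:
  assumes K: "imaginary_quadratic_field K" and xyz: "x \<in> K" "y \<in> K" "z \<in> K"
  obtains a b c :: int where "(a, b, c) \<noteq> (0, 0, 0)"
    "of_int a * x + of_int b * y + of_int c * z = 0"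
proof -
  interpret V: vector_space "\<lambda>(q::rat) (z::complex). of_rat q * z" by (rule rat_vector_space)
  have d: "V.dim K = 2" using K by (simp add: imaginary_quadratic_field_def)
  obtain B where B: "B \<subseteq> K" "V.independent B" "K \<subseteq> V.span B" "card B = V.dim K"
    using V.basis_exists by blast
  \<comment> \<open>\<open>card\<close> is 0 on infinite sets, so cardinality 2 forces
    finiteness.\<close>
  have finB: "finite B" using B d by (metis card.infinite zero_neq_numeral)
  have "\<exists>q1 q2 q3 :: rat. (q1, q2, q3) \<noteq> (0, 0, 0) \<and> of_rat q1 * x + of_rat q2 * y + of_rat q3 * z = 0"
  \<comment> \<open>Linear dependence is a property of the set \<open>{x, y, z}\<close>, which has
    three elements only if no two of them coincide.\<close>
  proof (cases "x = y \<or> x = z \<or> y = z")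
    case True
    then consider "x = y" | "x = z" | "y = z" by blast
    then show ?thesis
    proof cases
      case 1 then show ?thesis by (intro exI[of _ 1] exI[of _ "-1"] exI[of _ 0]) auto
    next
      case 2 then show ?thesis
        by (intro exI[of _ 1] exI[of _ "0::rat"] exI[of _ "-1"]) auto
    next
      case 3 then show ?thesis
        by (intro exI[of _ 0] exI[of _ "1::rat"] exI[of _ "-1"]) auto
    qed
  next
    case False
    have "\<not> V.independent {x, y, z}"
    proof
      assume ind: "V.independent {x, y, z}"
      have "card {x, y, z} \<le> card B"
        using V.independent_span_bound[OF finB ind] B(3) xyz by auto
      with False B(4) d show False by auto
    qed
    then obtain u where u: "(\<Sum>v\<in>{x,y,z}. of_rat (u v) * v) = 0" "\<exists>v\<in>{x,y,z}. u v \<noteq> 0"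
      using V.dependent_finite[of "{x,y,z}"] by auto
    then have "of_rat (u x) * x + of_rat (u y) * y + of_rat (u z) * z = 0"
      using False by (simp add: add.assoc)
    with u(2) show ?thesis by (intro exI[of _ "u x"] exI[of _ "u y"] exI[of _ "u z"]) auto
  qed
  then obtain q1 q2 q3 :: rat where q: "(q1, q2, q3) \<noteq> (0, 0, 0)"
    "of_rat q1 * x + of_rat q2 * y + of_rat q3 * z = 0" by blast
  have "\<exists>m n. n \<noteq> 0 \<and> q = of_int m / of_int n" for q :: rat
    by (metis Fract_of_int_quotient less_int_code(1) quotient_of_denom_pos quotient_of_div surjective_pairing)
  then obtain m1 n1 m2 n2 m3 n3 :: int where
    mn: "n1 \<noteq> 0" "q1 = of_int m1 / of_int n1" "n2 \<noteq> 0" "q2 = of_int m2 / of_int n2"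
        "n3 \<noteq> 0" "q3 = of_int m3 / of_int n3" by metis
  show thesis
  proof (rule that[of "m1 * n2 * n3" "m2 * n1 * n3" "m3 * n1 * n2"])
    show "(m1 * n2 * n3, m2 * n1 * n3, m3 * n1 * n2) \<noteq> (0, 0, 0)"
      using q(1) mn by auto
    have "0 = of_int (n1 * n2 * n3) * (of_rat q1 * x + of_rat q2 * y + of_rat q3 * z :: complex)"
      using q(2) by simp
    also have "\<dots> = of_int (m1 * n2 * n3) * x + of_int (m2 * n1 * n3) * y + of_int (m3 * n1 * n2) * z"
      using mn(1,3,5) unfolding mn(2,4,6) by (simp add: of_rat_divide field_simps)
    finally show "of_int (m1 * n2 * n3) * x + of_int (m2 * n1 * n3) * y + of_int (m3 * n1 * n2) * z = 0" ..
  qed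
qed

lemma nonreal_int_linear:
  assumes "z \<notin> \<real>" "of_int a * z + of_int b = (0::complex)"
  shows "a = 0 \<and> b = 0"
proof -
  have "Im z \<noteq> 0" using assms(1) complex_is_Real_iff by blast
  moreover have "Im (of_int a * z + of_int b) = 0" "Re (of_int a * z + of_int b) = 0"
    using assms(2) by simp_all
  ultimately show ?thesis by auto
qed

text \<open>Vieta: the second root is the conjugate of \<open>z\<close>, so the product of the roots
  is the squared absolute value. The imaginary part of the equation gives
  \<open>2 a Re z = - b\<close>; substituting this into the real part avoids division by
  \<open>a\<close>.\<close>

lemma nonreal_quadratic_norm:
  assumes "z \<notin> \<real>" "of_int a * z\<^sup>2 + of_int b * z + of_int c = (0::complex)"
  shows "of_int a * (cmod z)\<^sup>2 = (of_int c :: real)"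
proof -
  have i: "Im z \<noteq> 0" using assms(1) complex_is_Real_iff by blast
  have re: "of_int a * ((Re z)\<^sup>2 - (Im z)\<^sup>2) + of_int b * Re z + of_int c = 0"
    using arg_cong[OF assms(2), of Re] by (simp add: power2_eq_square)
  have "of_int a * (2 * Re z * Im z) + of_int b * Im z = 0"
    using arg_cong[OF assms(2), of Im] by (simp add: power2_eq_square algebra_simps)
  then have "Im z * (2 * of_int a * Re z + of_int b) = 0" by (simp add: algebra_simps)
  then have *: "2 * of_int a * Re z = - of_int b" using i by simp
  have "of_int b = - (2 * of_int a * Re z)" using * by simp
  with re show "of_int a * (cmod z)\<^sup>2 = (of_int c :: real)"
    unfolding cmod_power2 by (simp add: power2_eq_square algebra_simps)
qed

text \<open>Gauss's lemma in disguise: the primitive quadratic polynomial of \<open>z\<close> pseudo-divides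
  the monic polynomial of \<open>z\<close>, and comparing contents and leading coefficients forces
  its leading coefficient to be a unit.\<close>

lemma algebraic_int_norm_square:
  fixes z :: complex
  assumes alg: "algebraic_int z" and nr: "z \<notin> \<real>"
    and rel: "of_int a * z\<^sup>2 + of_int b * z + of_int c = 0" and a: "a \<noteq> 0"
  shows "(cmod z)\<^sup>2 \<in> \<int>"
proof -
  define f0 where "f0 = [:c, b, a:]"
  define f where "f = primitive_part f0"
  have f0: "f0 \<noteq> 0" "degree f0 = 2" using a by (auto simp: f0_def)
  have f0f: "f0 = smult (content f0) f" by (simp add: f_def)
  have ev0: "poly (map_poly of_int f0) z = 0"
    using rel by (simp add: f0_def map_poly_pCons algebra_simps power2_eq_square)
  have c0: "content f0 \<noteq> 0" using f0 by simp
  have hom: "map_poly of_int (p + q) = map_poly of_int p + (map_poly of_int q :: complex poly)"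
    "map_poly of_int (p * q) = map_poly of_int p * (map_poly of_int q :: complex poly)"
    "map_poly of_int (smult k p) = smult (of_int k) (map_poly of_int p :: complex poly)" for p q k
    by (auto intro!: poly_eqI simp: coeff_map_poly coeff_mult)
  have ev: "poly (map_poly of_int f) z = 0"
  proof -
    have "map_poly of_int f0 = smult (of_int (content f0)) (map_poly of_int f :: complex poly)"
      using hom(3)[of "content f0" f] unfolding f0f[symmetric] .
    then have "of_int (content f0) * poly (map_poly of_int f) z = 0" using ev0 by simp
    with c0 show ?thesis by simp
  qed
  have fd: "degree f = 2" "f \<noteq> 0" "content f = 1"
    using f0 by (auto simp: f_def content_primitive_part)
  obtain P where P: "poly (map_poly of_int P) z = 0" "lead_coeff P = (1::int)"
    using alg by (auto simp: algebraic_int_altdef_ipoly)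
  obtain e q where eq: "e \<noteq> 0" "smult e P = f * q + pseudo_mod P f"
    using pseudo_mod(1)[OF fd(2)] by blast
  define r where "r = pseudo_mod P f"
  have r0: "poly (map_poly of_int r) z = 0"
  proof -
    have "poly (map_poly of_int (smult e P)) z = poly (map_poly of_int (f * q + r)) z"
      using eq(2) by (simp add: r_def)
    then show ?thesis using P(1) ev by (simp add: hom)
  qed
  have rdeg: "degree r < 2"
    using pseudo_mod(2)[OF fd(2), of P] fd(1) by (auto simp: r_def)
  define r0' r1' where "r0' = coeff r 0" and "r1' = coeff r 1"
  have rr: "r = [:r0', r1':]"
    using rdeg by (intro poly_eqI)
      (auto simp: r0'_def r1'_def coeff_pCons coeff_eq_0 split: nat.split)
  have "of_int r1' * z + of_int r0' = 0"
    using r0 by (simp add: rr map_poly_pCons algebra_simps)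
  \<comment> \<open>A nonreal number is not a root of a nonzero integer polynomial of degree below
    2.\<close>
  then have "r = 0" using nonreal_int_linear[OF nr] rr by auto
  then have main: "smult e P = f * q" using eq r_def by simp
  have cP: "content P = 1"
    by (metis P(2) content_dvd_coeff is_unit_content_iff)
  have "normalize e = content q"
    using arg_cong[OF main, of content] fd(3) cP by (simp add: content_mult)
  moreover have "e = lead_coeff f * lead_coeff q"
    using arg_cong[OF main, of lead_coeff] P(2) eq(1) by (simp add: lead_coeff_mult)
  moreover have "content q dvd lead_coeff q" by simp
  \<comment> \<open>\<open>e\<close> is associate to \<open>content q\<close>, which divides
    \<open>lead_coeff q\<close>; multiplying by \<open>lead_coeff f\<close> turns the latter into
    \<open>e\<close> again.\<close>
  ultimately have "e * lead_coeff f dvd e"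
    by (metis dvd_normalize_iff mult_dvd_mono dvd_refl mult.commute normalize_dvd_iff)
  then have u: "lead_coeff f dvd 1" using eq(1) by (metis dvd_mult_cancel_left mult.right_neutral)
  define A B C where "A = coeff f 2" and "B = coeff f 1" and "C = coeff f 0"
  have fABC: "f = [:C, B, A:]"
    using fd(1) by (intro poly_eqI) (auto simp: A_def B_def C_def coeff_pCons numeral_2_eq_2 coeff_eq_0 split: nat.split)
  have A: "A = 1 \<or> A = -1" using u fd(1) by (auto simp: A_def)
  have "of_int A * z\<^sup>2 + of_int B * z + of_int C = 0"
    using ev by (simp add: fABC map_poly_pCons algebra_simps power2_eq_square)
  from nonreal_quadratic_norm[OF nr this] A have "(cmod z)\<^sup>2 = of_int C \<or> (cmod z)\<^sup>2 = of_int (- C)"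
    by auto
  then show ?thesis by (metis Ints_of_int)
qed

lemma imaginary_quadratic_nonreal:
  assumes "imaginary_quadratic_field K"
  obtains w where "w \<in> K" "w \<notin> \<real>"
  using assms unfolding imaginary_quadratic_field_def by blast

text \<open>A nonreal \<open>v\<close> satisfies an integral quadratic relation, whose monic form
  shows that the norm is an integer. A real \<open>v\<close> is rational: in a relation between a
  nonreal \<open>w\<close>, \<open>v\<close> and 1 the imaginary part eliminates \<open>w\<close>.
  Rational algebraic integers are ordinary integers.\<close>

lemma ring_of_integers_norm_square:
  assumes K: "imaginary_quadratic_field K" and v: "v \<in> ring_of_integers K"
  shows "\<exists>N::nat. (cmod v)\<^sup>2 = real N"
proof -
  have vK: "v \<in> K" and alg: "algebraic_int v" using v by (auto simp: ring_of_integers_def)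
  have cl: "1 \<in> K" "\<And>x y. x \<in> K \<Longrightarrow> y \<in> K \<Longrightarrow> x * y \<in> K"
    using K by (auto simp: imaginary_quadratic_field_def complex_subfield_def)
  have "(cmod v)\<^sup>2 \<in> \<int>"
  proof (cases "v \<in> \<real>")
    case True
    obtain w where w: "w \<in> K" "w \<notin> \<real>" using imaginary_quadratic_nonreal[OF K] .
    obtain a b c where abc: "(a, b, c) \<noteq> (0::int, 0::int, 0::int)"
      "of_int a * w + of_int b * v + of_int c * 1 = 0"
      using imaginary_quadratic_int_relation[OF K w(1) vK cl(1)] .
    obtain x where x: "v = of_real x" using True by (auto elim: Reals_cases)
    have "Im w \<noteq> 0" using w(2) complex_is_Real_iff by blast
    moreover have "Im (of_int a * w + of_int b * v + of_int c * 1) = 0" using abc(2) by simp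
    ultimately have a: "a = 0" by (simp add: x)
    have bv: "of_int b * v = - of_int c"
      using abc(2) by (simp add: a eq_neg_iff_add_eq_0)
    have "b \<noteq> 0" using abc(1) bv a by auto
    then have "v = - of_int c / of_int b" using bv by (simp add: field_simps)
    then have "v \<in> \<rat>" by simp
    then have "v \<in> \<int>" using alg rational_algebraic_int_is_int by blast
    then obtain m where "v = of_int m" by (auto elim: Ints_cases)
    then show ?thesis by (simp add: norm_of_int flip: of_int_abs of_int_power)
  next
    case False
    obtain a b c where abc: "(a, b, c) \<noteq> (0::int, 0::int, 0::int)"
      "of_int a * (v * v) + of_int b * v + of_int c * 1 = 0"
      using imaginary_quadratic_int_relation[OF K cl(2)[OF vK vK] vK cl(1)] .
    have "a \<noteq> 0" using abc nonreal_int_linear[OF False, of b c] by auto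
    then show ?thesis
      using algebraic_int_norm_square[OF alg False, of a b c] abc(2) by (simp add: power2_eq_square)
  qed
  then obtain m where m: "(cmod v)\<^sup>2 = of_int m" by (auto elim: Ints_cases)
  then have "m \<ge> 0" by (metis of_int_0_le_iff zero_le_power2)
  then have "(cmod v)\<^sup>2 = real (nat m)" using m by simp
  then show ?thesis ..
qed

text \<open>The order \<open>\<int>[\<tau>]\<close> inside the ring of integers suffices for the approximation of
  complex numbers, and it avoids the closure of algebraic integers under ring operations.\<close>

lemma imaginary_quadratic_order:
  assumes K: "imaginary_quadratic_field K"
  obtains \<Lambda> D where "\<Lambda> \<subseteq> ring_of_integers K" "1 \<in> \<Lambda>"
    "\<And>x y. x \<in> \<Lambda> \<Longrightarrow> y \<in> \<Lambda> \<Longrightarrow> x * y \<in> \<Lambda>"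
    "D > 0" "\<And>z. \<exists>w\<in>\<Lambda>. w \<noteq> 0 \<and> cmod (z - w) \<le> D"
proof -
  have cl: "0 \<in> K" "1 \<in> K" "\<And>x y. x \<in> K \<Longrightarrow> y \<in> K \<Longrightarrow> x * y \<in> K"
    "\<And>x y. x \<in> K \<Longrightarrow> y \<in> K \<Longrightarrow> x + y \<in> K" "\<And>x. x \<in> K \<Longrightarrow> - x \<in> K"
    using K by (auto simp: imaginary_quadratic_field_def complex_subfield_def)
  have natK: "of_nat n \<in> K" for n by (induction n) (auto intro: cl)
  have intK: "of_int n \<in> K" for n
    by (cases n rule: int_cases2) (auto intro: cl natK)
  obtain w where w: "w \<in> K" "w \<notin> \<real>" using imaginary_quadratic_nonreal[OF K] .
  obtain a b c where abc: "(a, b, c) \<noteq> (0::int, 0::int, 0::int)"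
      "of_int a * (w * w) + of_int b * w + of_int c * 1 = 0"
    using imaginary_quadratic_int_relation[OF K cl(3)[OF w(1) w(1)] w(1) cl(2)] .
  have a: "a \<noteq> 0" using abc nonreal_int_linear[OF w(2), of b c] by auto
  \<comment> \<open>Scaling by the leading coefficient makes \<open>w\<close> integral:
    \<open>\<tau>\<close> is a root of the monic polynomial \<open>X^2 + b X + a c\<close>.\<close>
  define \<tau> where "\<tau> = of_int a * w"
  have tK: "\<tau> \<in> K" by (auto simp: \<tau>_def intro: cl intK w)
  have Imt: "Im \<tau> \<noteq> 0" using w(2) a by (auto simp: \<tau>_def complex_is_Real_iff)
  have "\<tau> * \<tau> + of_int b * \<tau> + of_int (a * c) = of_int a * (of_int a * (w * w) + of_int b * w + of_int c * 1)"
    by (simp add: \<tau>_def algebra_simps)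
  then have t: "\<tau> * \<tau> + of_int b * \<tau> + of_int (a * c) = 0" using abc(2) by simp
  define N where "N = a * c"
  have t2: "\<tau> * \<tau> = - of_int b * \<tau> - of_int N" using t unfolding N_def by algebra
  define \<Lambda> where "\<Lambda> = {of_int m + of_int n * \<tau> | m n :: int. True}"
  have alg: "algebraic_int (of_int m + of_int n * \<tau>)" for m n :: int
  proof -
    \<comment> \<open>The characteristic polynomial of \<open>m + n \<tau>\<close>, with trace
      \<open>2 m - b n\<close> and norm \<open>m^2 - b m n + n^2 N\<close>.\<close>
    let ?p = "[:m * m - b * m * n + n * n * N, - (2 * m - b * n), 1:] :: int poly"
    have e: "of_int (m * m - b * m * n + n * n * N) - of_int (2 * m - b * n) * (of_int m + of_int n * \<tau>)
        + (of_int m + of_int n * \<tau>) * (of_int m + of_int n * \<tau>) =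
        of_int (n * n) * (\<tau> * \<tau> + of_int b * \<tau> + of_int N)"
      by (simp add: algebra_simps)
    have "\<tau> * \<tau> + of_int b * \<tau> + of_int N = 0" using t by (simp add: N_def)
    then have "of_int (m * m - b * m * n + n * n * N) - of_int (2 * m - b * n) * (of_int m + of_int n * \<tau>)
        + (of_int m + of_int n * \<tau>) * (of_int m + of_int n * \<tau>) = 0"
      unfolding e by simp
    then have "poly (map_poly of_int ?p) (of_int m + of_int n * \<tau>) = 0"
      by (simp add: map_poly_pCons algebra_simps)
    moreover have "lead_coeff ?p = 1" by simp
    ultimately show ?thesis by (auto simp: algebraic_int_altdef_ipoly)
  qed
  have sub: "\<Lambda> \<subseteq> ring_of_integers K"
    using alg by (auto simp: \<Lambda>_def ring_of_integers_def intro!: cl intK tK)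
  have mul: "x * y \<in> \<Lambda>" if mem: "x \<in> \<Lambda>" "y \<in> \<Lambda>" for x y
  proof -
    obtain m n m' n' where xy: "x = of_int m + of_int n * \<tau>" "y = of_int m' + of_int n' * \<tau>"
      using mem unfolding \<Lambda>_def by blast
    have "x * y = of_int (m * m') + of_int (m * n' + n * m') * \<tau> + of_int (n * n') * (\<tau> * \<tau>)"
      by (simp add: xy algebra_simps)
    also have "\<dots> = of_int (m * m' - n * n' * N) + of_int (m * n' + n * m' - n * n' * b) * \<tau>"
      unfolding t2 by (simp add: algebra_simps)
    finally show ?thesis unfolding \<Lambda>_def by blast
  qed
  have one: "1 \<in> \<Lambda>" unfolding \<Lambda>_def by (rule CollectI, rule exI[of _ 1], rule exI[of _ 0]) simp
  define D where "D = 2 + cmod \<tau>"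
  have "\<exists>w\<in>\<Lambda>. w \<noteq> 0 \<and> cmod (z - w) \<le> D" for z
  proof -
    \<comment> \<open>In the real basis 1, \<open>\<tau>\<close> of the plane, both coordinates of
      \<open>z\<close> are rounded down, first that of \<open>\<tau>\<close>, then that of
      1.\<close>
    define n where "n = \<lfloor>Im z / Im \<tau>\<rfloor>"
    define y where "y = Im z / Im \<tau> - of_int n"
    have y: "0 \<le> y" "y \<le> 1" unfolding y_def n_def by linarith+
    define u where "u = Re z - of_int n * Re \<tau>"
    define v where "v = u - y * Re \<tau>"
    have zz: "z = of_real v + of_int n * \<tau> + of_real y * \<tau>"
      using Imt by (simp add: complex_eq_iff v_def u_def y_def algebra_simps)
    \<comment> \<open>Dependent vectors have nonzero coordinates, so a rounding to 0 is replaced by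
      a neighbouring lattice point; \<open>D\<close> leaves room for this.\<close>
    define m where "m = (if of_int \<lfloor>v\<rfloor> + of_int n * \<tau> = 0 then \<lfloor>v\<rfloor> + 1 else \<lfloor>v\<rfloor>)"
    have mv: "\<bar>v - of_int m\<bar> \<le> 2" unfolding m_def by (auto, linarith+)
    have nz: "of_int m + of_int n * \<tau> \<noteq> 0"
    proof (cases "of_int \<lfloor>v\<rfloor> + of_int n * \<tau> = 0")
      case True
      then have "of_int m + of_int n * \<tau> = 1 + (of_int \<lfloor>v\<rfloor> + of_int n * \<tau>)" by (simp add: m_def)
      then show ?thesis using True by simp
    next
      case False then show ?thesis by (simp add: m_def)
    qed
    have "z - (of_int m + of_int n * \<tau>) = of_real (v - of_int m) + of_real y * \<tau>"
      by (subst zz) simp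
    then have "cmod (z - (of_int m + of_int n * \<tau>)) \<le> \<bar>v - of_int m\<bar> + y * cmod \<tau>"
      by (metis abs_of_nonneg norm_mult norm_of_real norm_triangle_ineq y(1))
    also have "\<dots> \<le> 2 + 1 * cmod \<tau>" by (intro add_mono mult_right_mono mv y) auto
    finally have "cmod (z - (of_int m + of_int n * \<tau>)) \<le> D" by (simp add: D_def)
    then show ?thesis using nz unfolding \<Lambda>_def by blast
  qed
  moreover have "D > 0" by (simp add: D_def add_pos_nonneg)
  ultimately show thesis using that[OF sub one mul] by blast
qed

section \<open>Elementary properties of the covering radius\<close>

lemma cnorm_nonneg: "0 \<le> cnorm n z"
  by (simp add: cnorm_def)

lemma cnorm_component: "i < n \<Longrightarrow> cmod (z i) \<le> cnorm n z"
  unfolding cnorm_def by (rule member_le_L2_set) auto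

lemma cnorm_le_sum: "cnorm n z \<le> (\<Sum>i<n. cmod (z i))"
  unfolding cnorm_def by (rule L2_set_le_sum) auto

lemma cnorm_diff_le: "cnorm n (\<lambda>i. x i - y i) \<le> cnorm n x + cnorm n y"
proof -
  have "cnorm n (\<lambda>i. x i - y i) \<le> L2_set (\<lambda>i. cmod (x i) + cmod (y i)) {..<n}"
    unfolding cnorm_def by (intro L2_set_mono norm_triangle_ineq4) auto
  also have "\<dots> \<le> cnorm n x + cnorm n y"
    unfolding cnorm_def by (rule L2_set_triangle_ineq)
  finally show ?thesis .
qed

lemma ones_mult_dep:
  assumes "1 \<in> R" "n \<ge> 1"
  shows "(\<lambda>i\<in>{..<n}. 1) \<in> mult_dep_vectors n R"
proof -
  have "\<exists>k::nat \<Rightarrow> int. (\<exists>i<n. k i \<noteq> 0) \<and> (\<Prod>i<n. (\<lambda>i\<in>{..<n}. 1::complex) i powi k i) = 1"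
    using assms by (intro exI[of _ "\<lambda>i. 1"] conjI exI[of _ 0]) auto
  then show ?thesis using assms
    by (auto simp: mult_dep_vectors_def cspace_def mult_dependent_def)
qed

lemma dist_bdd_below: "bdd_below ((\<lambda>v. cnorm n (\<lambda>i. x i - v i)) ` S)"
  by (rule bdd_belowI[of _ 0]) (auto simp: cnorm_nonneg)

text \<open>The all-ones vector serves every \<open>x\<close> at once. This uniform bound makes the
  supremum in \<open>mu\<close> one of a set that is bounded above.\<close>

lemma dist_ones_le:
  assumes "1 \<in> R" "n \<ge> 1" "cnorm n x \<le> H"
  shows "(INF v \<in> mult_dep_vectors n R. cnorm n (\<lambda>i. x i - v i)) \<le> H + real n"
proof -
  have "(INF v \<in> mult_dep_vectors n R. cnorm n (\<lambda>i. x i - v i)) \<le> cnorm n (\<lambda>i. x i - (\<lambda>i\<in>{..<n}. 1) i)"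
    by (rule cINF_lower[OF dist_bdd_below ones_mult_dep[OF assms(1,2)]])
  also have "\<dots> \<le> cnorm n x + cnorm n (\<lambda>i\<in>{..<n}. 1)" by (rule cnorm_diff_le)
  also have "cnorm n (\<lambda>i\<in>{..<n}. 1) \<le> real n" using cnorm_le_sum[of n "\<lambda>i\<in>{..<n}. 1"] by simp
  finally show ?thesis using assms(3) by simp
qed

lemma mu_lowerI:
  assumes "1 \<in> R" "n \<ge> 1" "x \<in> cspace n" "cnorm n x \<le> H"
    and "\<And>v. v \<in> mult_dep_vectors n R \<Longrightarrow> \<rho> \<le> cnorm n (\<lambda>i. x i - v i)"
  shows "\<rho> \<le> mu n H R"
proof -
  have "\<rho> \<le> (INF v \<in> mult_dep_vectors n R. cnorm n (\<lambda>i. x i - v i))"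
    using ones_mult_dep[OF assms(1,2)] by (intro cINF_greatest assms(5)) auto
  also have "\<dots> \<le> mu n H R" unfolding mu_def
    using assms(3,4) dist_ones_le[OF assms(1,2)]
    by (intro cSUP_upper bdd_aboveI[of _ "H + real n"]) auto
  finally show ?thesis .
qed

lemma mu_upperI:
  assumes "H \<ge> 0"
    and "\<And>x. x \<in> cspace n \<Longrightarrow> cnorm n x \<le> H \<Longrightarrow>
           \<exists>v \<in> mult_dep_vectors n R. cnorm n (\<lambda>i. x i - v i) \<le> \<rho>"
  shows "mu n H R \<le> \<rho>"
proof -
  have "(\<lambda>i\<in>{..<n}. 0) \<in> {x \<in> cspace n. cnorm n x \<le> H}"
    using assms(1) cnorm_le_sum[of n "\<lambda>i\<in>{..<n}. 0"] by (auto simp: cspace_def)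
  moreover have "(INF v \<in> mult_dep_vectors n R. cnorm n (\<lambda>i. x i - v i)) \<le> \<rho>"
    if x: "x \<in> cspace n" "cnorm n x \<le> H" for x
  proof -
    obtain v where "v \<in> mult_dep_vectors n R" "cnorm n (\<lambda>i. x i - v i) \<le> \<rho>"
      using assms(2)[OF x] by blast
    then show ?thesis using cINF_lower[OF dist_bdd_below] order_trans by metis
  qed
  ultimately show ?thesis unfolding mu_def by (intro cSUP_least) auto
qed

text \<open>Comparison with the all-ones vector. This is enough for the upper bound in dimension 2
  and for bounded ranges of \<open>H\<close> in higher dimension.\<close>

lemma mu_le_trivial:
  assumes "1 \<in> R" "n \<ge> 1" "H \<ge> 0"
  shows "mu n H R \<le> H + real n"
proof (rule mu_upperI[OF assms(3)])
  fix x assume x: "x \<in> cspace n" "cnorm n x \<le> H"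
  have "cnorm n (\<lambda>i. x i - (\<lambda>i\<in>{..<n}. 1) i) \<le> cnorm n x + cnorm n (\<lambda>i\<in>{..<n}. 1)"
    by (rule cnorm_diff_le)
  also have "cnorm n (\<lambda>i\<in>{..<n}. 1) \<le> real n" using cnorm_le_sum[of n "\<lambda>i\<in>{..<n}. 1"] by simp
  finally show "\<exists>v \<in> mult_dep_vectors n R. cnorm n (\<lambda>i. x i - v i) \<le> H + real n"
    using ones_mult_dep[OF assms(1,2)] x(2) by (intro bexI[of _ "\<lambda>i\<in>{..<n}. 1"]) auto
qed

lemma norm_square_nat_ge_1:
  assumes "(cmod v)\<^sup>2 = real N" "v \<noteq> 0"
  shows "N \<ge> 1" "cmod v \<ge> 1"
proof -
  have "real N > 0" using assms by (metis zero_less_norm_iff zero_less_power)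
  then show "N \<ge> 1" by simp
  then have "1\<^sup>2 \<le> (cmod v)\<^sup>2" using assms(1) by simp
  then show "cmod v \<ge> 1" by (rule power2_le_imp_le) simp
qed

text \<open>The origin has distance at least 1 from every candidate, as nonzero elements of
  \<open>R\<close> have absolute value at least 1. This covers small \<open>H\<close> in the lower
  bounds and shows that \<open>mu\<close> is positive.\<close>

lemma mu_ge_1:
  assumes "1 \<in> R" "n \<ge> 1" "H \<ge> 0"
    and norm: "\<And>v. v \<in> R \<Longrightarrow> \<exists>N::nat. (cmod v)\<^sup>2 = real N"
  shows "1 \<le> mu n H R"
proof (rule mu_lowerI[OF assms(1,2), where x = "\<lambda>i\<in>{..<n}. 0"])
  show "(\<lambda>i\<in>{..<n}. 0) \<in> cspace n" by (simp add: cspace_def)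
  show "cnorm n (\<lambda>i\<in>{..<n}. 0) \<le> H" using assms(3) cnorm_le_sum[of n "\<lambda>i\<in>{..<n}. 0"] by simp
  fix v assume v: "v \<in> mult_dep_vectors n R"
  then have "v 0 \<in> R" "v 0 \<noteq> 0" using assms(2) by (auto simp: mult_dep_vectors_def mult_dependent_def)
  then have "1 \<le> cmod (v 0)" using norm norm_square_nat_ge_1 by blast
  also have "\<dots> = cmod ((\<lambda>i\<in>{..<n}. 0) 0 - v 0)" using assms(2) by simp
  also have "\<dots> \<le> cnorm n (\<lambda>i. (\<lambda>i\<in>{..<n}. 0) i - v i)"
    using assms(2) by (intro cnorm_component) auto
  finally show "1 \<le> cnorm n (\<lambda>i. (\<lambda>i\<in>{..<n}. 0) i - v i)" .
qed

section \<open>Relations between natural numbers\<close>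

text \<open>Taking absolute values discards the arguments and leaves a linear relation between
  logarithms, a necessary condition for dependence that the lower bounds refute.\<close>

lemma mult_dep_log_relation:
  assumes "mult_dependent n v"
  obtains k :: "nat \<Rightarrow> int" where "\<exists>i<n. k i \<noteq> 0" "(\<Sum>i<n. of_int (k i) * ln (cmod (v i))) = 0"
proof -
  obtain k :: "nat \<Rightarrow> int" where k: "\<exists>i<n. k i \<noteq> 0" "(\<Prod>i<n. v i powi k i) = 1"
    and nz: "\<And>i. i < n \<Longrightarrow> v i \<noteq> 0"
    using assms by (auto simp: mult_dependent_def)
  have "(\<Sum>i<n. of_int (k i) * ln (cmod (v i))) = (\<Sum>i<n. ln (cmod (v i) powi k i))"
    using nz by (intro sum.cong refl) (simp add: powr_real_of_int' [symmetric] ln_powr)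
  also have "\<dots> = ln (\<Prod>i<n. cmod (v i) powi k i)"
    using nz by (subst ln_prod) auto
  also have "(\<Prod>i<n. cmod (v i) powi k i) = cmod (\<Prod>i<n. v i powi k i)"
    by (simp add: norm_power_int flip: prod_norm)
  finally show thesis using that[OF k(1)] k(2) by simp
qed

section \<open>The lower bound in dimension 2\<close>

text \<open>A nontrivial relation reads \<open>N0 ^ a = N1 ^ b\<close> with
  \<open>0 < a < b\<close>, because \<open>N1 < N0\<close>. Hence \<open>N1 ^ a\<close> divides
  \<open>N0 ^ a\<close>, so \<open>N1\<close> divides \<open>N0\<close>, which a quotient strictly
  between 1 and 2 forbids.\<close>

lemma no_relation_of_close_norms:
  fixes N0 N1 :: nat and k0 k1 :: int
  assumes N: "1 < N1" "N1 < N0" "N0 < 2 * N1"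
    and rel: "of_int k0 * ln (real N0) + of_int k1 * ln (real N1) = 0"
  shows "k0 = 0 \<and> k1 = 0"
proof -
  have pos: False if k: "k0 > 0" and rel: "of_int k0 * ln (real N0) + of_int k1 * ln (real N1) = 0" for k0 k1 :: int
  proof -
    have l: "0 < ln (real N1)" "ln (real N1) < ln (real N0)" using N by auto
    have "of_int k0 * ln (real N1) < of_int k0 * ln (real N0)" using k l(2) by simp
    then have "of_int k0 * ln (real N1) < of_int (- k1) * ln (real N1)" using rel by simp
    then have "real_of_int k0 < of_int (- k1)" using l(1) mult_less_cancel_right_pos by blast
    then have kk: "k0 < - k1" by linarith
    define a b where "a = nat k0" and "b = nat (- k1)"
    have ab: "0 < a" "a < b" "of_int k0 = real a" "of_int (- k1) = real b"
      using k kk by (auto simp: a_def b_def)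
    have k1: "real_of_int k1 = - real b" using ab(4) by simp
    have "real a * ln (real N0) = real b * ln (real N1)" using rel unfolding ab(3) k1 by simp
    then have "ln (real N0 ^ a) = ln (real N1 ^ b)" using N by (simp add: ln_realpow)
    then have "real N0 ^ a = real N1 ^ b" using N by (subst (asm) ln_inj_iff) auto
    then have "N0 ^ a = N1 ^ b" by (metis of_nat_eq_iff of_nat_power)
    then have "N1 ^ a dvd N0 ^ a" using ab(2) by (simp add: le_imp_power_dvd)
    then have "N1 dvd N0" using ab(1) by (simp add: pow_divides_pow_iff)
    then obtain m where m: "N0 = N1 * m" by (auto elim: dvdE)
    then have "m \<noteq> 0" "m \<noteq> 1" using N by auto
    then have "2 \<le> m" by simp
    then have "N1 * 2 \<le> N1 * m" by (intro mult_left_mono) auto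
    with m N(3) show False by simp
  qed
  have "k0 = 0"
    using pos[OF _ rel] pos[of "- k0" "- k1"] rel by (cases k0 "0::int" rule: linorder_cases) auto
  then show ?thesis using rel N by simp
qed

text \<open>The point \<open>(4/5 H, 3/5 H)\<close> has norm \<open>H\<close>. The squared absolute
  values of its coordinates have ratio 16/9, and moving each coordinate by less than
  \<open>H / 100\<close> keeps this ratio strictly between 1 and 2.\<close>

lemma mu_2_lower:
  assumes R: "1 \<in> R" and H: "H \<ge> 2"
    and norm: "\<And>v. v \<in> R \<Longrightarrow> \<exists>N::nat. (cmod v)\<^sup>2 = real N"
  shows "H / 100 \<le> mu 2 H R"
proof -
  define x :: "nat \<Rightarrow> complex" where
    "x = (\<lambda>i\<in>{..<2}. if i = 0 then of_real (4/5 * H) else of_real (3/5 * H))"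
  have x01: "x 0 = of_real (4/5 * H)" "x 1 = of_real (3/5 * H)" by (simp_all add: x_def)
  have s2: "{..<2} = {0, 1::nat}" by auto
  have nx: "cmod (x 0) = 4/5 * H" "cmod (x 1) = 3/5 * H"
    using H unfolding x01 norm_of_real by simp_all
  show ?thesis
  proof (rule mu_lowerI[OF R, where x = x])
    show "(1::nat) \<le> 2" by simp
    show "x \<in> cspace 2" by (auto simp: x_def cspace_def)
    have "(cnorm 2 x)\<^sup>2 = (4/5 * H)\<^sup>2 + (3/5 * H)\<^sup>2"
      unfolding cnorm_def L2_set_def s2 by (simp add: nx[unfolded One_nat_def])
    also have "\<dots> = H\<^sup>2" by (simp add: power2_eq_square)
    finally have "(cnorm 2 x)\<^sup>2 \<le> H\<^sup>2" by simp
    then show "cnorm 2 x \<le> H" using H power2_le_imp_le[of "cnorm 2 x" H] by simp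
    fix v assume v: "v \<in> mult_dep_vectors 2 R"
    show "H / 100 \<le> cnorm 2 (\<lambda>i. x i - v i)"
    proof (rule ccontr)
      assume "\<not> ?thesis"
      then have "cmod (x 0 - v 0) < H / 100" "cmod (x 1 - v 1) < H / 100"
        using cnorm_component[of 0 2 "\<lambda>i. x i - v i"] cnorm_component[of 1 2 "\<lambda>i. x i - v i"] by auto
      then have b: "cmod (v 0) < 81/100 * H" "79/100 * H < cmod (v 0)"
          "cmod (v 1) < 61/100 * H" "59/100 * H < cmod (v 1)"
        using nx norm_triangle_ineq2[of "x 0" "v 0"] norm_triangle_ineq3[of "x 0" "v 0"]
          norm_triangle_ineq2[of "x 1" "v 1"] norm_triangle_ineq3[of "x 1" "v 1"] by linarith+
      have vR: "v 0 \<in> R" "v 1 \<in> R" and md: "mult_dependent 2 v"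
        using v by (auto simp: mult_dep_vectors_def)
      obtain N0 N1 :: nat where N: "(cmod (v 0))\<^sup>2 = real N0" "(cmod (v 1))\<^sup>2 = real N1"
        using norm vR by metis
      have "(59/100 * H)\<^sup>2 < (cmod (v 1))\<^sup>2" "(cmod (v 0))\<^sup>2 < (81/100 * H)\<^sup>2" "(cmod (v 1))\<^sup>2 < (cmod (v 0))\<^sup>2"
        using b H by (intro power_strict_mono; simp)+
      \<comment> \<open>Numerically, \<open>81^2 = 6561\<close> against
        \<open>2 * 59^2 = 6962\<close>.\<close>
      moreover have "(81/100 * H)\<^sup>2 \<le> 2 * (59/100 * H)\<^sup>2" by (simp add: power2_eq_square)
      \<comment> \<open>The assumption \<open>H >= 2\<close> enters here, to give
        \<open>N1 > 1\<close>.\<close>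
      moreover have "1 < (59/100 * H)\<^sup>2"
      proof -
        have "(118/100)\<^sup>2 \<le> (59/100 * H)\<^sup>2" using H by (intro power_mono) auto
        then show ?thesis by (simp add: power2_eq_square)
      qed
      ultimately have r: "1 < real N1" "real N1 < real N0" "real N0 < 2 * real N1"
        unfolding N by linarith+
      then have NN: "1 < N1" "N1 < N0" "N0 < 2 * N1" by linarith+
      obtain k where k: "\<exists>i<2. k i \<noteq> (0::int)" "(\<Sum>i<2. of_int (k i) * ln (cmod (v i))) = 0"
        using mult_dep_log_relation[OF md] .
      have v0: "v 0 \<noteq> 0" "v 1 \<noteq> 0" using b H by auto
      have "ln (real N0) = 2 * ln (cmod (v 0))" "ln (real N1) = 2 * ln (cmod (v 1))"
        using v0 unfolding N[symmetric] by (simp_all add: ln_realpow)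
      then have "of_int (k 0) * ln (real N0) + of_int (k 1) * ln (real N1) = 0"
        using k(2) by (simp add: s2)
      then have "k 0 = 0 \<and> k 1 = 0" by (rule no_relation_of_close_norms[OF NN])
      then show False using k(1) by (auto simp: less_2_cases_iff)
    qed
  qed
qed

section \<open>Bounds for the exponents of multiplicative relations\<close>

text \<open>Fraction-free Gaussian elimination: the last column is eliminated with a pivot \<open>p0\<close>.\<close>

lemma bounded_int_relation:
  fixes e :: "'p \<Rightarrow> nat \<Rightarrow> int"
  assumes "\<And>p i. i < n \<Longrightarrow> \<bar>e p i\<bar> \<le> E" "\<exists>i<n. k i \<noteq> 0" "\<And>p. (\<Sum>i<n. k i * e p i) = 0" "E \<ge> 1"
  shows "\<exists>k'. (\<exists>i<n. k' i \<noteq> 0) \<and> (\<forall>i<n. \<bar>k' i\<bar> \<le> (2 * int n * E) ^ (2 ^ n - 1)) \<and>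
              (\<forall>p. (\<Sum>i<n. k' i * e p i) = 0)"
  using assms
proof (induction n arbitrary: e E k)
  case 0
  then show ?case by simp
next
  case (Suc n)
  define W :: nat where "W = 2 ^ n - 1"
  have "(2::nat) ^ n \<ge> 1" by simp
  \<comment> \<open>One elimination step squares the size of the entries, so the exponent in the
    bound goes from \<open>W\<close> to \<open>2 W + 1\<close>.\<close>
  then have W: "2 ^ Suc n - 1 = Suc (2 * W)" unfolding W_def power_Suc by linarith
  have big: "1 \<le> (2 * int (Suc n) * E) ^ (2 ^ Suc n - 1)"
    using Suc.prems(4) mult_mono[of 1 "2 * int (Suc n)" 1 E] by (intro one_le_power) simp
  show ?case
  proof (cases "\<forall>p. e p n = 0")
    case True
    \<comment> \<open>If the last column vanishes, the last unit vector is a relation.\<close>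
    then show ?thesis using big by (intro exI[of _ "\<lambda>i. if i = n then 1 else 0"]) auto
  next
    case False
    then obtain p0 where p0: "e p0 n \<noteq> 0" by blast
    define d where "d = e p0 n"
    define e' where "e' = (\<lambda>p i. d * e p i - e p0 i * e p n)"
    have d: "d \<noteq> 0" "\<bar>d\<bar> \<le> E" using p0 Suc.prems(1)[of n p0] by (auto simp: d_def)
    have e'E: "\<bar>e' p i\<bar> \<le> 2 * E\<^sup>2" if "i < n" for p i
    proof -
      have "\<bar>e' p i\<bar> \<le> \<bar>d\<bar> * \<bar>e p i\<bar> + \<bar>e p0 i\<bar> * \<bar>e p n\<bar>"
        unfolding e'_def by (metis abs_mult abs_triangle_ineq4)
      also have "\<dots> \<le> E * E + E * E"
        using Suc.prems(1)[of i] Suc.prems(1)[of n] d(2) that Suc.prems(4)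
        by (intro add_mono mult_mono) auto
      finally show ?thesis by (simp add: power2_eq_square)
    qed
    \<comment> \<open>A relation supported on the last index alone would contradict the nonzero
      pivot.\<close>
    have nz: "\<exists>i<n. k i \<noteq> 0"
    proof (rule ccontr)
      assume "\<not> ?thesis"
      then have z: "k i = 0" if "i < n" for i using that by blast
      then have "k n \<noteq> 0" using Suc.prems(2) less_Suc_eq by auto
      moreover have "k n * e p0 n = 0" using Suc.prems(3)[of p0] z by simp
      ultimately show False using p0 by simp
    qed
    have rel': "(\<Sum>i<n. k i * e' p i) = 0" for p
    proof -
      have s: "(\<Sum>i<n. k i * e q i) = - k n * e q n" for q
        using Suc.prems(3)[of q] by simp
      have "(\<Sum>i<n. k i * e' p i) = d * (\<Sum>i<n. k i * e p i) - (\<Sum>i<n. k i * e p0 i) * e p n"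
        by (simp add: e'_def sum_subtractf sum_distrib_left sum_distrib_right algebra_simps)
      then show ?thesis unfolding s by (simp add: d_def)
    qed
    have "1 \<le> 2 * E\<^sup>2" using Suc.prems(4) one_le_power[of E 2] by linarith
    then have "\<exists>k'. (\<exists>i<n. k' i \<noteq> 0) \<and> (\<forall>i<n. \<bar>k' i\<bar> \<le> (2 * int n * (2 * E\<^sup>2)) ^ (2 ^ n - 1)) \<and>
        (\<forall>p. (\<Sum>i<n. k' i * e' p i) = 0)"
      by (intro Suc.IH[of e' "2 * E\<^sup>2" k] e'E nz rel')
    then obtain k'' where k'': "\<exists>i<n. k'' i \<noteq> 0"
      "\<And>i. i < n \<Longrightarrow> \<bar>k'' i\<bar> \<le> (2 * int n * (2 * E\<^sup>2)) ^ W" "\<And>p. (\<Sum>i<n. k'' i * e' p i) = 0"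
      unfolding W_def by blast
    \<comment> \<open>Back substitution: the factor \<open>d\<close> on the first coordinates allows
      an integral last coordinate solving the pivot equation.\<close>
    define k' where "k' = (\<lambda>i. if i < n then d * k'' i else - (\<Sum>j<n. k'' j * e p0 j))"
    define Q where "Q = (2 * int n * (2 * E\<^sup>2)) ^ W"
    have Q0: "0 \<le> Q" by (simp add: Q_def)
    have n1: "1 \<le> n" using nz by auto
    have Qb: "int n * E * Q \<le> (2 * int (Suc n) * E) ^ (2 ^ Suc n - 1)"
    proof -
      have "Q \<le> ((2 * int (Suc n) * E) ^ 2) ^ W"
        unfolding Q_def
      proof (rule power_mono)
        have "int n \<le> int (Suc n) * int (Suc n)" by (simp add: algebra_simps)
        then have "int n * E\<^sup>2 \<le> (int (Suc n) * int (Suc n)) * E\<^sup>2" by (intro mult_right_mono) auto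
        then show "2 * int n * (2 * E\<^sup>2) \<le> (2 * int (Suc n) * E)\<^sup>2" by (simp add: power2_eq_square algebra_simps)
      qed simp
      moreover have "int n * E \<le> 2 * int (Suc n) * E" using Suc.prems(4) by (intro mult_right_mono) auto
      ultimately have "int n * E * Q \<le> (2 * int (Suc n) * E) * ((2 * int (Suc n) * E) ^ 2) ^ W"
        using Suc.prems(4) Q0 by (intro mult_mono) auto
      then show ?thesis unfolding W by (simp add: power_mult)
    qed
    have "(\<Sum>i<Suc n. k' i * e p i) = 0" for p
    proof -
      have "(\<Sum>i<Suc n. k' i * e p i) = (\<Sum>i<n. d * k'' i * e p i) - (\<Sum>j<n. k'' j * e p0 j) * e p n"
        by (simp add: k'_def)
      also have "\<dots> = (\<Sum>i<n. k'' i * e' p i)"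
        by (simp add: e'_def sum_subtractf sum_distrib_left sum_distrib_right algebra_simps)
      finally show ?thesis using k''(3) by simp
    qed
    moreover have "\<exists>i<Suc n. k' i \<noteq> 0" using k''(1) d(1) by (auto simp: k'_def less_Suc_eq)
    moreover have "\<bar>k' i\<bar> \<le> int n * E * Q" if "i < Suc n" for i
    proof (cases "i < n")
      case True
      have "\<bar>k' i\<bar> \<le> E * Q" using True k''(2)[OF True] d(2) Suc.prems(4)
        by (auto simp: k'_def abs_mult Q_def intro!: mult_mono)
      also have "\<dots> \<le> int n * (E * Q)" using n1 Q0 Suc.prems(4) mult_right_mono[of 1 "int n" "E * Q"] by auto
      finally show ?thesis by (simp add: mult.assoc)
    next
      case False
      then have "\<bar>k' i\<bar> \<le> (\<Sum>j<n. \<bar>k'' j * e p0 j\<bar>)" by (simp add: k'_def sum_abs)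
      also have "\<dots> \<le> (\<Sum>j<n. Q * E)"
        using k''(2) Suc.prems(1)[of _ p0] Q0 by (intro sum_mono) (auto simp: abs_mult Q_def intro!: mult_mono)
      finally show ?thesis by (simp add: algebra_simps)
    qed
    ultimately show ?thesis using Qb by (meson order_trans)
  qed
qed

text \<open>Unique factorization: with the exponents split into positive and negative parts, the
  relation says that two natural numbers agree, which is tested prime by prime. The result is a
  homogeneous linear system over the integers.\<close>

lemma ln_relation_iff_multiplicity:
  fixes N :: "nat \<Rightarrow> nat" and k :: "nat \<Rightarrow> int"
  assumes N: "\<And>i. i < n \<Longrightarrow> N i > 0"
  shows "(\<Sum>i<n. of_int (k i) * ln (real (N i))) = 0 \<longleftrightarrow>
         (\<forall>p. prime p \<longrightarrow> (\<Sum>i<n. k i * int (multiplicity p (N i))) = 0)"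
proof -
  define a b where "a = (\<lambda>i. nat (k i))" and "b = (\<lambda>i. nat (- k i))"
  have kab: "k i = int (a i) - int (b i)" for i by (simp add: a_def b_def)
  define A B where "A = (\<Prod>i<n. N i ^ a i)" and "B = (\<Prod>i<n. N i ^ b i)"
  have AB: "A > 0" "B > 0" using N by (auto simp: A_def B_def)
  have lnp: "ln (real (\<Prod>i<n. N i ^ c i)) = (\<Sum>i<n. real (c i) * ln (real (N i)))" for c
    using N by (simp, subst ln_prod) (auto simp: ln_realpow)
  have "(\<Sum>i<n. of_int (k i) * ln (real (N i))) = ln (real A) - ln (real B)"
    unfolding A_def B_def lnp by (simp add: kab algebra_simps sum_subtractf)
  then have "(\<Sum>i<n. of_int (k i) * ln (real (N i))) = 0 \<longleftrightarrow> A = B"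
    using AB by simp
  also have "\<dots> \<longleftrightarrow> (\<forall>p. prime p \<longrightarrow> multiplicity p A = multiplicity p B)"
    using multiplicity_eq_nat[OF AB] by blast
  also have "\<dots> \<longleftrightarrow> (\<forall>p. prime p \<longrightarrow> (\<Sum>i<n. k i * int (multiplicity p (N i))) = 0)"
  proof -
    have "multiplicity p (\<Prod>i<n. N i ^ c i) = (\<Sum>i<n. c i * multiplicity p (N i))" if "prime p" for p and c :: "nat \<Rightarrow> nat"
    proof -
      have "0 \<notin> (\<lambda>i. N i ^ c i) ` {..<n}" using N by fastforce
      then have "multiplicity p (\<Prod>i<n. N i ^ c i) = (\<Sum>i<n. multiplicity p (N i ^ c i))"
        using that by (intro prime_elem_multiplicity_prod_distrib) auto
      then show ?thesis using that N
        by (simp add: prime_elem_multiplicity_power_distrib)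
    qed
    then have "multiplicity p A = multiplicity p B \<longleftrightarrow> (\<Sum>i<n. k i * int (multiplicity p (N i))) = 0"
      if "prime p" for p
      using that unfolding A_def B_def
      by (simp add: kab algebra_simps sum_subtractf flip: of_nat_mult of_nat_sum)
    then show ?thesis by blast
  qed
  finally show ?thesis .
qed

text \<open>Numbers below \<open>2 ^ E\<close> have prime multiplicities below \<open>E\<close>, so
  elimination replaces an arbitrary relation by one with exponents controlled by \<open>n\<close>
  and \<open>E\<close>.\<close>

lemma bounded_nat_relation:
  fixes N :: "nat \<Rightarrow> nat"
  assumes N: "\<And>i. i < n \<Longrightarrow> N i > 0" "\<And>i. i < n \<Longrightarrow> N i < 2 ^ E" and E: "E \<ge> 1"
    and rel: "\<exists>i<n. k i \<noteq> 0" "(\<Sum>i<n. of_int (k i) * ln (real (N i))) = 0"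
  obtains k' :: "nat \<Rightarrow> int" where "\<exists>i<n. k' i \<noteq> 0" "\<And>i. i < n \<Longrightarrow> \<bar>k' i\<bar> \<le> int ((2 * n * E) ^ (2 ^ n))"
    "(\<Sum>i<n. of_int (k' i) * ln (real (N i))) = 0"
proof -
  \<comment> \<open>Zero rows at non-primes let all natural numbers index the system.\<close>
  define e where "e = (\<lambda>p i. if prime p then int (multiplicity p (N i)) else 0)"
  have n: "n \<ge> 1" using rel(1) by auto
  have eE: "\<bar>e p i\<bar> \<le> int E" if "i < n" for p i
  proof (cases "prime p")
    case True
    have "2 ^ multiplicity p (N i) \<le> p ^ multiplicity p (N i)"
      using prime_ge_2_nat[OF True] by (intro power_mono) auto
    also have "\<dots> \<le> N i" using N(1)[OF that] by (intro dvd_imp_le multiplicity_dvd) auto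
    also have "\<dots> < 2 ^ E" by (rule N(2)[OF that])
    finally have "multiplicity p (N i) < E" by simp
    then show ?thesis by (simp add: e_def)
  qed (simp add: e_def)
  have iff: "(\<Sum>i<n. of_int (c i) * ln (real (N i))) = 0 \<longleftrightarrow>
      (\<forall>p. prime p \<longrightarrow> (\<Sum>i<n. c i * int (multiplicity p (N i))) = 0)" for c
    by (rule ln_relation_iff_multiplicity) (rule N(1))
  have rel': "(\<Sum>i<n. k i * e p i) = 0" for p
    using rel(2) iff[of k] by (cases "prime p") (simp_all add: e_def)
  have "\<exists>k'. (\<exists>i<n. k' i \<noteq> 0) \<and> (\<forall>i<n. \<bar>k' i\<bar> \<le> (2 * int n * int E) ^ (2 ^ n - 1)) \<and>
      (\<forall>p. (\<Sum>i<n. k' i * e p i) = 0)"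
    using E by (intro bounded_int_relation[of n e "int E" k] eE rel(1) rel') auto
  then obtain k' where k': "\<exists>i<n. k' i \<noteq> 0"
    "\<And>i. i < n \<Longrightarrow> \<bar>k' i\<bar> \<le> (2 * int n * int E) ^ (2 ^ n - 1)" "\<And>p. (\<Sum>i<n. k' i * e p i) = 0"
    by blast
  have "(2 * int n * int E) ^ (2 ^ n - 1) \<le> (2 * int n * int E) ^ (2 ^ n)"
    using n E mult_mono[of 1 "2 * int n" 1 "int E"] by (intro power_increasing) simp_all
  also have "\<dots> = int ((2 * n * E) ^ (2 ^ n))" by simp
  finally have le: "(2 * int n * int E) ^ (2 ^ n - 1) \<le> int ((2 * n * E) ^ (2 ^ n))" .
  have "(\<Sum>i<n. of_int (k' i) * ln (real (N i))) = 0"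
    unfolding iff
  proof (intro allI impI)
    fix p :: nat assume "prime p"
    then show "(\<Sum>i<n. k' i * int (multiplicity p (N i))) = 0" using k'(3)[of p] by (simp add: e_def)
  qed
  then show thesis using that[OF k'(1)] k'(2) le order_trans by blast
qed

text \<open>Reduction modulo \<open>M\<close> shows that \<open>M\<close> divides
  \<open>k 0\<close>, which is smaller in absolute value and hence 0. Dividing by \<open>M\<close>
  then shifts the digits.\<close>

lemma base_expansion_zero:
  fixes k :: "nat \<Rightarrow> int" and M :: int
  assumes "\<And>i. i < n \<Longrightarrow> \<bar>k i\<bar> < M" "(\<Sum>i<n. k i * M ^ i) = 0" "i < n"
  shows "k i = 0"
  using assms
proof (induction n arbitrary: k i)
  case 0
  then show ?case by simp
next
  case (Suc n)
  have "(\<Sum>i<Suc n. k i * M ^ i) = k 0 + M * (\<Sum>i<n. k (Suc i) * M ^ i)"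
    by (subst sum.lessThan_Suc_shift) (simp add: sum_distrib_left algebra_simps)
  then have s: "k 0 + M * (\<Sum>i<n. k (Suc i) * M ^ i) = 0" using Suc.prems(2) by simp
  then have "k 0 = M * - (\<Sum>i<n. k (Suc i) * M ^ i)" by simp
  then have "M dvd k 0" by (metis dvd_triv_left)
  moreover have "\<bar>k 0\<bar> < M" using Suc.prems(1)[of 0] by simp
  ultimately have k0: "k 0 = 0" using zdvd_not_zless[of "\<bar>k 0\<bar>" M] by force
  have "M \<noteq> 0" using \<open>\<bar>k 0\<bar> < M\<close> by auto
  then have "(\<Sum>i<n. k (Suc i) * M ^ i) = 0" using s k0 by simp
  with Suc.IH[of "\<lambda>i. k (Suc i)"] Suc.prems(1) have "k (Suc j) = 0" if "j < n" for j using that by simp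
  then show ?case using k0 Suc.prems(3) by (cases i) auto
qed

text \<open>The inequality \<open>ln t <= t - 1\<close>, applied to both \<open>t\<close> and
  \<open>1 / t\<close>.\<close>

lemma abs_ln_le:
  fixes t \<delta> :: real
  assumes "\<bar>t - 1\<bar> \<le> \<delta>" "\<delta> \<le> 1/2"
  shows "\<bar>ln t\<bar> \<le> 2 * \<delta>"
proof -
  have t: "t \<ge> 1/2" using assms by linarith
  have "ln t \<le> t - 1" using t by (intro ln_le_minus_one) auto
  moreover have "ln (1 / t) \<le> 1 / t - 1" using t by (intro ln_le_minus_one) auto
  moreover have "1 / t - 1 \<le> 2 * \<delta>"
  proof -
    have "1 - t \<le> \<delta> * (2 * t)"
      using assms t mult_left_mono[of 1 "2 * t" \<delta>] by linarith
    then show ?thesis using t by (simp add: field_simps)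
  qed
  moreover have "ln (1 / t) = - ln t" using t by (simp add: ln_div)
  ultimately show ?thesis using assms by linarith
qed

section \<open>The lower bound\<close>

text \<open>The point with coordinates \<open>(H / n) exp (- M ^ i / M ^ n)\<close> is far from all dependent
  vectors: a relation between the absolute values near it has exponents bounded by \<open>B\<close>; the
  coefficient of \<open>ln (H / n)\<close> must vanish, and then base \<open>M\<close> expansions exclude the rest.\<close>

lemma mu_lower_explicit:
  fixes R :: "complex set" and n E B M :: nat
  assumes R: "1 \<in> R" and n: "n \<ge> 1"
    and norm: "\<And>v. v \<in> R \<Longrightarrow> \<exists>N::nat. (cmod v)\<^sup>2 = real N"
    and E: "E \<ge> 1" "(2 * H)\<^sup>2 < 2 ^ E" and H: "H \<ge> real n * exp 2"
    and B: "B = (2 * n * E) ^ (2 ^ n)" and M: "M = 2 * n * B"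
  shows "H / (12 * real n ^ 2 * real B * real M ^ n) \<le> mu n H R"
proof -
  have n0: "real n \<ge> 1" using n by simp
  have B1: "B \<ge> 1" unfolding B using n E(1) by (intro one_le_power) (simp add: Suc_le_eq)
  have M2: "M \<ge> 2" "M > B" "n * B < M" using n B1 by (auto simp: M)
  have H0: "H > 0" using H n0 by (smt (verit) exp_gt_zero mult_pos_pos)
  have Hn: "ln (H / real n) \<ge> 2"
  proof -
    have "exp 2 \<le> H / real n" using H n0 by (simp add: field_simps)
    then show ?thesis using H0 n0 by (subst ln_ge_iff) auto
  qed
  define c where "c = (\<lambda>i. real M ^ i / real M ^ n)"
  define y where "y = (\<lambda>i. H / real n * exp (- c i))"
  define x :: "nat \<Rightarrow> complex" where "x = (\<lambda>i\<in>{..<n}. of_real (y i))"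
  define \<rho> where "\<rho> = H / (12 * real n ^ 2 * real B * real M ^ n)"
  have c: "0 \<le> c i" "c i \<le> 1 / real M" if "i < n" for i
  proof -
    show "0 \<le> c i" by (simp add: c_def)
    have "real M ^ Suc i \<le> real M ^ n" using that M2 by (intro power_increasing) auto
    then show "c i \<le> 1 / real M" using M2 by (simp add: c_def field_simps)
  qed
  have y: "y i > 0" "y i \<le> H / real n" "y i \<ge> H / (3 * real n)" if "i < n" for i
  proof -
    show "y i > 0" using H0 n0 by (simp add: y_def)
    have "H / real n * exp (- c i) \<le> H / real n * 1" using c[OF that] H0 n0 by (intro mult_left_mono) auto
    then show "y i \<le> H / real n" by (simp add: y_def)
    have "1 / real M \<le> 1" using M2 by simp
    then have "c i \<le> 1" using c(2)[OF that] by linarith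
    then have "exp (- 1) \<le> exp (- c i)" by simp
    moreover have "1 / 3 \<le> exp (- 1::real)"
      using exp_le by (simp add: exp_minus field_simps)
    ultimately have "1 / 3 \<le> exp (- c i)" by linarith
    then have "H / real n * (1 / 3) \<le> H / real n * exp (- c i)"
      using H0 by (intro mult_left_mono) simp_all
    then show "y i \<ge> H / (3 * real n)" by (simp add: y_def)
  qed
  have nx: "cmod (x i) = y i" if "i < n" for i using y(1)[OF that] that by (simp add: x_def)
  have "\<rho> \<le> mu n H R"
  proof (rule mu_lowerI[OF R n, where x = x])
    show "x \<in> cspace n" by (auto simp: x_def cspace_def)
    have "cnorm n x \<le> (\<Sum>i<n. cmod (x i))" by (rule cnorm_le_sum)
    also have "\<dots> \<le> (\<Sum>i<n. H / real n)" using nx y(2) by (intro sum_mono) auto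
    finally show "cnorm n x \<le> H" using n0 by simp
    fix v assume v: "v \<in> mult_dep_vectors n R"
    show "\<rho> \<le> cnorm n (\<lambda>i. x i - v i)"
    proof (rule ccontr)
      assume "\<not> ?thesis"
      then have near: "cmod (x i - v i) < \<rho>" if "i < n" for i
        using cnorm_component[OF that, of "\<lambda>i. x i - v i"] by simp
      have vR: "v i \<in> R" "v i \<noteq> 0" if "i < n" for i
        using v that by (auto simp: mult_dep_vectors_def mult_dependent_def)
      have "\<forall>i. \<exists>N::nat. i < n \<longrightarrow> (cmod (v i))\<^sup>2 = real N" using norm vR(1) by blast
      then obtain N where N: "\<And>i. i < n \<Longrightarrow> (cmod (v i))\<^sup>2 = real (N i)" by metis
      have N0: "N i > 0" if "i < n" for i
        using norm_square_nat_ge_1(1)[OF N[OF that] vR(2)[OF that]] by simp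
      have lnN: "ln (real (N i)) = 2 * ln (cmod (v i))" if "i < n" for i
        using vR(2)[OF that] unfolding N[OF that, symmetric] by (simp add: ln_realpow)
      define t where "t = (\<lambda>i. cmod (v i) / y i)"
      \<comment> \<open>\<open>\<rho>\<close> is \<open>\<delta>\<close> times the lower bound
        \<open>H / (3 n)\<close> for the coordinates, so \<open>\<delta>\<close> bounds relative
        errors. With \<open>n\<close> exponents of size at most \<open>B\<close>, logarithmic errors
        of \<open>2 \<delta>\<close> add up to \<open>1 / (2 M^n)\<close>, half the unit of the base
        \<open>M\<close> expansion.\<close>
      define \<delta> where "\<delta> = 1 / (4 * real n * real B * real M ^ n)"
      have \<delta>: "\<delta> \<le> 1/2" "0 < \<delta>"
      proof -
        have "1 \<le> real n * real B * real M ^ n"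
          using n0 B1 M2 mult_mono[of 1 "real n * real B" 1 "real M ^ n"] mult_mono[of 1 "real n" 1 "real B"]
          by (simp add: one_le_power)
        then show "\<delta> \<le> 1/2" "0 < \<delta>" by (simp_all add: \<delta>_def field_simps)
      qed
      have t1: "\<bar>t i - 1\<bar> \<le> \<delta>" if i: "i < n" for i
      proof -
        have "\<bar>cmod (v i) - y i\<bar> \<le> \<rho>"
          using near[OF i] norm_triangle_ineq3[of "v i" "x i"] unfolding nx[OF i]
          by (simp add: norm_minus_commute)
        also have "\<rho> = \<delta> * (H / (3 * real n))" using n0
          by (simp add: \<rho>_def \<delta>_def field_simps power2_eq_square)
        also have "\<dots> \<le> \<delta> * y i" using y(3)[OF i] \<delta>(2) by (intro mult_left_mono) auto
        finally have "\<bar>cmod (v i) - y i\<bar> / y i \<le> \<delta>" using y(1)[OF i] by (simp add: field_simps)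
        moreover have "t i - 1 = (cmod (v i) - y i) / y i" using y(1)[OF i] by (simp add: t_def field_simps)
        ultimately show ?thesis using y(1)[OF i] by simp
      qed
      have lt: "\<bar>ln (t i)\<bar> \<le> 2 * \<delta>" if "i < n" for i using abs_ln_le[OF t1[OF that] \<delta>(1)] .
      have NE: "N i < 2 ^ E" if i: "i < n" for i
      proof -
        have "cmod (v i) = t i * y i" using y(1)[OF i] by (simp add: t_def)
        also have "\<dots> \<le> 2 * H"
        proof -
          have "y i \<le> H" using y(2)[OF i] n0 H0 by (smt (verit) divide_le_eq mult_le_cancel_left1)
          then show ?thesis using t1[OF i] \<delta> y(1)[OF i] H0 by (intro mult_mono) auto
        qed
        finally have "(cmod (v i))\<^sup>2 \<le> (2 * H)\<^sup>2" by (intro power_mono) auto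
        with E(2) have "real (N i) < 2 ^ E" unfolding N[OF i] by linarith
        then show ?thesis by (metis of_nat_less_numeral_power_cancel_iff)
      qed
      have md: "mult_dependent n v" using v by (simp add: mult_dep_vectors_def)
      obtain k0 where k0: "\<exists>i<n. k0 i \<noteq> (0::int)" "(\<Sum>i<n. of_int (k0 i) * ln (cmod (v i))) = 0"
        using mult_dep_log_relation[OF md] .
      have "(\<Sum>i<n. of_int (k0 i) * ln (real (N i))) = 2 * (\<Sum>i<n. of_int (k0 i) * ln (cmod (v i)))"
        by (simp add: sum_distrib_left lnN mult.left_commute)
      with k0(2) have "(\<Sum>i<n. of_int (k0 i) * ln (real (N i))) = 0" by simp
      from bounded_nat_relation[OF N0 NE E(1) k0(1) this] obtain k where
        k: "\<exists>i<n. k i \<noteq> 0" "\<And>i. i < n \<Longrightarrow> \<bar>k i\<bar> \<le> int B" "(\<Sum>i<n. of_int (k i) * ln (real (N i))) = 0"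
        unfolding B by blast
      have kB: "\<bar>real_of_int (k i)\<bar> \<le> real B" if "i < n" for i
        using k(2)[OF that] by linarith
      define \<kappa> where "\<kappa> = (\<Sum>i<n. k i)"
      have "(\<Sum>i<n. of_int (k i) * ln (real (N i))) = 2 * (\<Sum>i<n. of_int (k i) * ln (cmod (v i)))"
        by (simp add: sum_distrib_left lnN mult.left_commute)
      also have "(\<Sum>i<n. of_int (k i) * ln (cmod (v i))) =
          (\<Sum>i<n. of_int (k i) * (ln (t i) + ln (H / real n) - c i))"
      proof (intro sum.cong refl)
        fix i assume "i \<in> {..<n}"
        then have i: "i < n" by simp
        have "t i > 0" using t1[OF i] \<delta>(1) by (auto simp: abs_le_iff)
        have "cmod (v i) = t i * y i" using y(1)[OF i] by (simp add: t_def)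
        then have "cmod (v i) = t i * (H / real n) * exp (- c i)" by (simp add: y_def)
        moreover have "ln (u * h * exp (- e)) = ln u + ln h - e" if "u > 0" "h > 0" for u h e :: real
          using that by (simp add: ln_mult)
        moreover have "H / real n > 0" using H0 n0 by simp
        ultimately have "ln (cmod (v i)) = ln (t i) + ln (H / real n) - c i"
          using \<open>t i > 0\<close> by (simp only:)
        then show "of_int (k i) * ln (cmod (v i)) = of_int (k i) * (ln (t i) + ln (H / real n) - c i)"
          by simp
      qed
      also have "\<dots> = (\<Sum>i<n. of_int (k i) * ln (t i)) + of_int \<kappa> * ln (H / real n) - (\<Sum>i<n. of_int (k i) * c i)"
        by (simp add: \<kappa>_def algebra_simps sum.distrib sum_subtractf sum_distrib_left sum_distrib_right)
      finally have main: "(\<Sum>i<n. of_int (k i) * ln (t i)) + of_int \<kappa> * ln (H / real n) - (\<Sum>i<n. of_int (k i) * c i) = 0"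
        using k(3) by simp
      have "\<bar>\<Sum>i<n. of_int (k i) * ln (t i)\<bar> \<le> (\<Sum>i<n. \<bar>of_int (k i) * ln (t i)\<bar>)" by (rule sum_abs)
      also have "\<dots> \<le> (\<Sum>i<n. real B * (2 * \<delta>))"
        using kB lt by (intro sum_mono) (auto simp: abs_mult intro!: mult_mono)
      also have "\<dots> = 1 / (2 * real M ^ n)" using n0 B1 by (simp add: \<delta>_def field_simps)
      finally have S1: "\<bar>\<Sum>i<n. of_int (k i) * ln (t i)\<bar> \<le> 1 / (2 * real M ^ n)" .
      have Mn: "1 \<le> real M ^ n" using M2 by (intro one_le_power) auto
      have S1': "1 / (2 * real M ^ n) \<le> 1/2" using Mn frac_le[of 1 1 2 "2 * real M ^ n"] by linarith
      have "\<bar>\<Sum>i<n. of_int (k i) * c i\<bar> \<le> (\<Sum>i<n. \<bar>of_int (k i) * c i\<bar>)" by (rule sum_abs)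
      also have "\<dots> \<le> (\<Sum>i<n. real B * (1 / real M))"
      proof (rule sum_mono)
        fix i assume "i \<in> {..<n}"
        then have "\<bar>real_of_int (k i)\<bar> * c i \<le> real B * (1 / real M)" "0 \<le> c i"
          using kB c by (auto intro!: mult_mono simp del: times_divide_eq_right mult_1_right)
        then show "\<bar>of_int (k i) * c i\<bar> \<le> real B * (1 / real M)" by (simp add: abs_mult)
      qed
      also have "\<dots> = 1 / 2" using n0 B1 by (simp add: M field_simps)
      finally have S2: "\<bar>\<Sum>i<n. of_int (k i) * c i\<bar> \<le> 1 / 2" .
      \<comment> \<open>A nonzero \<open>\<kappa>\<close> would contribute at least 2, since
        \<open>H >= n exp 2\<close>; the perturbation and, by \<open>M = 2 n B\<close>, the offsets
        contribute at most 1/2 each.\<close>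
      have \<kappa>0: "\<kappa> = 0"
      proof (rule ccontr)
        assume "\<kappa> \<noteq> 0"
        then have "1 \<le> \<bar>real_of_int \<kappa>\<bar>" by linarith
        then have "1 * 2 \<le> \<bar>real_of_int \<kappa>\<bar> * ln (H / real n)" using Hn by (intro mult_mono) auto
        also have "\<dots> = \<bar>of_int \<kappa> * ln (H / real n)\<bar>" using Hn by (simp add: abs_mult)
        finally show False using main S1 S1' S2 by linarith
      qed
      \<comment> \<open>After scaling by \<open>M^n\<close>, the remaining sum is an integer of
        absolute value at most 1/2, hence 0.\<close>
      have "(\<Sum>i<n. of_int (k i) * c i) = of_int (\<Sum>i<n. k i * int M ^ i) / real M ^ n"
        by (simp add: c_def sum_divide_distrib)
      then have "\<bar>of_int (\<Sum>i<n. k i * int M ^ i) / real M ^ n\<bar> \<le> 1 / (2 * real M ^ n)"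
        using main \<kappa>0 S1 by simp
      moreover have "\<bar>a\<bar> \<le> 1 / 2" if "\<bar>a / m\<bar> \<le> 1 / (2 * m)" "m \<ge> 1" for a m :: real
        using that by (simp add: abs_divide field_simps)
      ultimately have "\<bar>real_of_int (\<Sum>i<n. k i * int M ^ i)\<bar> \<le> 1 / 2"
        using Mn by blast
      then have "(\<Sum>i<n. k i * int M ^ i) = 0" by linarith
      moreover have "\<bar>k i\<bar> < int M" if "i < n" for i using k(2)[OF that] M2 by linarith
      ultimately have "k i = 0" if "i < n" for i using base_expansion_zero[of n k "int M"] that by blast
      then show False using k(1) by blast
    qed
  qed
  then show ?thesis by (simp add: \<rho>_def)
qed

lemma ln_ge_1: "H \<ge> 3 \<Longrightarrow> ln H \<ge> (1::real)"
  using exp_le by (subst ln_ge_iff) auto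

text \<open>With \<open>E\<close> of order \<open>ln H\<close>, the bound \<open>B\<close> is of
  order \<open>(ln H) ^ (2 ^ n)\<close>, and the denominator of \<open>mu_lower_explicit\<close>
  contains \<open>B ^ (n + 1)\<close>. The resulting exponent \<open>2 ^ n * (n + 1)\<close> is
  rounded up to \<open>2 ^ (2 n)\<close>. For \<open>H\<close> below \<open>n exp 2\<close> the
  bound \<open>mu >= 1\<close> suffices.\<close>

lemma mu_lower_log:
  fixes R :: "complex set" and n :: nat
  assumes R: "1 \<in> R" and n: "n \<ge> 1"
    and norm: "\<And>v. v \<in> R \<Longrightarrow> \<exists>N::nat. (cmod v)\<^sup>2 = real N"
  shows "\<exists>c>0. \<forall>H\<ge>3. \<bar>H / ln H powr (2 ^ (2 * n))\<bar> \<le> c * mu n H R"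
proof -
  define P :: nat where "P = 2 ^ n * (n + 1)"
  define Q :: nat where "Q = 2 ^ (2 * n)"
  have PQ: "P \<le> Q"
  proof -
    have "n + 1 \<le> 2 ^ n" by (induction n) auto
    then have "2 ^ n * (n + 1) \<le> 2 ^ n * 2 ^ n" by (intro mult_left_mono) auto
    then show ?thesis by (simp add: P_def Q_def mult_2 power_add)
  qed
  define K where "K = 12 * real n ^ 2 * (2 * real n) ^ n * (16 * real n) ^ P"
  define c where "c = max K (real n * exp 2)"
  have n0: "real n \<ge> 1" using n by simp
  have K: "K > 0" using n0 by (simp add: K_def)
  have c: "c > 0" "K \<le> c" "real n * exp 2 \<le> c" using K by (auto simp: c_def)
  have "\<bar>H / ln H powr (2 ^ (2 * n))\<bar> \<le> c * mu n H R" if H: "H \<ge> 3" for H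
  proof -
    have lnH: "ln H \<ge> 1" using ln_ge_1[OF H] .
    have pw: "ln H powr (2 ^ (2 * n)) = ln H ^ Q"
      using lnH powr_realpow[of "ln H" Q] by (simp add: Q_def)
    have lnQ: "1 \<le> ln H ^ Q" using lnH by (intro one_le_power) auto
    have abs: "\<bar>H / ln H powr (2 ^ (2 * n))\<bar> = H / ln H ^ Q"
      unfolding pw using H lnQ by simp
    have mu1: "1 \<le> mu n H R" using mu_ge_1[OF R n _ norm] H by simp
    show ?thesis
    proof (cases "H \<ge> real n * exp 2")
      case False
      have "H / ln H ^ Q \<le> H" using lnQ H by (simp add: divide_le_eq)
      also have "\<dots> \<le> c * 1" using False c by simp
      also have "\<dots> \<le> c * mu n H R" using mu1 c by (intro mult_left_mono) auto
      finally show ?thesis unfolding abs .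
    next
      case True
      \<comment> \<open>The factor 7 works because \<open>(2 H)^2 < H^4\<close> and
        \<open>7 ln 2 > 4\<close>; rounding up costs at most one more \<open>ln H\<close>.\<close>
      define E where "E = nat \<lceil>7 * ln H\<rceil>"
      have E: "7 * ln H \<le> real E" "real E \<le> 8 * ln H" "E \<ge> 1"
        using lnH unfolding E_def by linarith+
      have "(2 * H)\<^sup>2 < 2 ^ E"
      proof -
        have "(2 * H)\<^sup>2 = 4 * H\<^sup>2" by simp
        also have "\<dots> < H\<^sup>2 * H\<^sup>2"
        proof -
          have "3\<^sup>2 \<le> H\<^sup>2" using H by (intro power_mono) auto
          then show ?thesis by (intro mult_strict_right_mono) auto
        qed
        also have "\<dots> = H ^ 4" by (simp flip: power_add)
        also have "\<dots> = exp (4 * ln H)" using H exp_of_nat_mult[of 4 "ln H"] by simp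
        also have "\<dots> \<le> exp (7 * ln H * ln 2)"
        proof -
          have "4 \<le> 7 * ln (2::real)" using ln2_ge_two_thirds by linarith
          then have "4 * ln H \<le> (7 * ln 2) * ln H" using lnH by (intro mult_right_mono) auto
          then show ?thesis by (simp add: algebra_simps)
        qed
        also have "\<dots> \<le> exp (real E * ln 2)" using E(1) by (simp add: mult_right_mono)
        also have "\<dots> = 2 ^ E" by (simp add: exp_of_nat_mult)
        finally show ?thesis .
      qed
      note low = mu_lower_explicit[OF R n norm E(3) this True refl refl]
      define B where "B = (2 * n * E) ^ (2 ^ n)"
      have B: "real B \<le> (16 * real n * ln H) ^ (2 ^ n)"
      proof -
        have "real B = (2 * real n * real E) ^ (2 ^ n)" by (simp add: B_def)
        also have "\<dots> \<le> (16 * real n * ln H) ^ (2 ^ n)"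
        proof (rule power_mono)
          have "2 * real n * real E \<le> 2 * real n * (8 * ln H)" using E(2) by (intro mult_left_mono) auto
          then show "2 * real n * real E \<le> 16 * real n * ln H" by simp
        qed simp
        finally show ?thesis .
      qed
      have "B \<ge> 1" unfolding B_def using n E(3) by (intro one_le_power) (simp add: Suc_le_eq)
      then have B1: "real B \<ge> 1" by simp
      have low': "H / (12 * real n ^ 2 * (2 * real n) ^ n * real B ^ (n + 1)) \<le> mu n H R"
        using low unfolding B_def[symmetric] by (simp add: power_mult_distrib algebra_simps)
      have "real B ^ (n + 1) \<le> ((16 * real n * ln H) ^ (2 ^ n)) ^ (n + 1)"
        using B by (intro power_mono) auto
      also have "\<dots> = (16 * real n) ^ P * ln H ^ P"
        unfolding P_def power_mult[symmetric] by (simp only: power_mult_distrib)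
      also have "\<dots> \<le> (16 * real n) ^ P * ln H ^ Q"
        using lnH PQ by (intro mult_left_mono power_increasing) auto
      finally have "12 * real n ^ 2 * (2 * real n) ^ n * real B ^ (n + 1) \<le> 12 * real n ^ 2 * (2 * real n) ^ n * ((16 * real n) ^ P * ln H ^ Q)"
        by (intro mult_left_mono) auto
      also have "\<dots> = K * ln H ^ Q" by (simp add: K_def)
      finally have den: "12 * real n ^ 2 * (2 * real n) ^ n * real B ^ (n + 1) \<le> K * ln H ^ Q" .
      have "0 < 12 * real n ^ 2 * (2 * real n) ^ n * real B ^ (n + 1)"
        using n0 B1 by (intro mult_pos_pos zero_less_power) auto
      then have "H / (K * ln H ^ Q) \<le> H / (12 * real n ^ 2 * (2 * real n) ^ n * real B ^ (n + 1))"
        using H by (intro frac_le den) auto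
      also have "\<dots> \<le> mu n H R" by (rule low')
      finally have "H / ln H ^ Q \<le> K * mu n H R" using K lnQ by (simp add: field_simps)
      also have "\<dots> \<le> c * mu n H R" using mu1 c(2) by (intro mult_right_mono) auto
      finally show ?thesis unfolding abs .
    qed
  qed
  then show ?thesis using c(1) by blast
qed

section \<open>Computability of the exponent\<close>

lemma recursive_fn_comp1:
  assumes "recursive_fn 1 F" "recursive_fn m g"
  shows "recursive_fn m (\<lambda>xs. F [g xs])"
  using recursive_fn.comp[of "[g]" F m] assms by simp

lemma recursive_fn_comp2:
  assumes "recursive_fn 2 F" "recursive_fn m g" "recursive_fn m h"
  shows "recursive_fn m (\<lambda>xs. F [g xs, h xs])"
  using recursive_fn.comp[of "[g, h]" F m] assms by (simp add: numeral_2_eq_2)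

text \<open>The form \<open>hd xs + tl xs ! 0\<close> is the one that \<open>prec\<close> produces.
  As functions on all lists it cannot simply be exchanged for \<open>xs ! 0 + xs ! 1\<close>, since
  the two need not agree on the empty list.\<close>

lemma recursive_fn_add: "recursive_fn 2 (\<lambda>xs. hd xs + tl xs ! 0)"
proof -
  have "recursive_fn (Suc 0) (\<lambda>xs. xs ! 0)" by (intro recursive_fn.proj) simp
  moreover have "recursive_fn (Suc (Suc (Suc 0))) (\<lambda>xs. Suc (xs ! 1))"
    using recursive_fn_comp1[OF recursive_fn.succ recursive_fn.proj[of 1]] by simp
  ultimately have "recursive_fn (Suc (Suc 0))
      (\<lambda>xs. rec_nat (tl xs ! 0) (\<lambda>k r. Suc ((k # r # tl xs) ! 1)) (hd xs))"
    by (rule recursive_fn.prec)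
  moreover have "rec_nat a (\<lambda>k r. Suc ((k # r # ys) ! 1)) n = n + a" for a n :: nat and ys
    by (induction n) auto
  ultimately show ?thesis by (simp add: numeral_2_eq_2)
qed

lemma recursive_fn_power2: "recursive_fn 1 (\<lambda>xs. 2 ^ hd xs)"
proof -
  have "recursive_fn 0 (\<lambda>xs. Suc 0)"
    using recursive_fn_comp1[OF recursive_fn.succ recursive_fn.zero] by simp
  moreover have "recursive_fn (Suc (Suc 0)) (\<lambda>xs. xs ! 1 + xs ! 1)"
    using recursive_fn_comp2[OF recursive_fn_add recursive_fn.proj[of 1] recursive_fn.proj[of 1]] by simp
  ultimately have "recursive_fn (Suc 0)
      (\<lambda>xs. rec_nat (Suc 0) (\<lambda>k r. (k # r # tl xs) ! 1 + (k # r # tl xs) ! 1) (hd xs))"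
    by (rule recursive_fn.prec)
  moreover have "rec_nat (Suc 0) (\<lambda>k r. (k # r # ys) ! 1 + (k # r # ys) ! 1) n = 2 ^ n" for n :: nat and ys
    by (induction n) auto
  ultimately show ?thesis by simp
qed

text \<open>The dyadic approximations are exact: the numerator is \<open>2 ^ (n + n + k)\<close>,
  and the subtracted function is 0.\<close>

lemma computable_power2_double: "computable_real_seq (\<lambda>n. 2 ^ (2 * n))"
proof -
  have pr: "recursive_fn 2 (\<lambda>xs. xs ! 0)" "recursive_fn 2 (\<lambda>xs. xs ! 1)"
    by (intro recursive_fn.proj; simp)+
  have "recursive_fn 2 (\<lambda>xs. xs ! 0 + xs ! 0)"
    using recursive_fn_comp2[OF recursive_fn_add pr(1) pr(1)] by simp
  from recursive_fn_comp2[OF recursive_fn_add this pr(2)]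
  have "recursive_fn 2 (\<lambda>xs. xs ! 0 + xs ! 0 + xs ! 1)" by simp
  from recursive_fn_comp1[OF recursive_fn_power2 this]
  have "recursive_fn 2 (\<lambda>xs. 2 ^ (xs ! 0 + xs ! 0 + xs ! 1))" by simp
  moreover have "recursive_fn 2 (\<lambda>xs. 0)" by (rule recursive_fn.zero)
  ultimately show ?thesis unfolding computable_real_seq_def
    by (intro exI conjI allI) (assumption, assumption, simp add: power_add mult_2)
qed

section \<open>Approximation by dependent triples\<close>

text \<open>If \<open>c\<close> still exceeds \<open>f m + d\<close>, then one more step stays below
  \<open>c\<close>. This selects the exponent with which a monomial reaches a prescribed absolute
  value.\<close>

lemma discrete_intermediate_value:
  fixes f :: "nat \<Rightarrow> real"
  assumes "f 0 \<le> c" "\<And>j. f (Suc j) \<le> f j + d" "c \<le> f m + d"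
  shows "\<exists>j\<le>m. f j \<le> c \<and> c \<le> f j + d"
  using assms(3)
proof (induction m)
  case 0
  then show ?case using assms(1) by auto
next
  case (Suc m)
  show ?case
  proof (cases "c \<le> f m + d")
    case True
    then show ?thesis using Suc.IH le_SucI by blast
  next
    case False
    then show ?thesis using assms(2)[of m] Suc.prems by (intro exI[of _ "Suc m"]) auto
  qed
qed

section \<open>Perturbation of monomials\<close>

lemma norm_exp_minus_1_le:
  fixes e :: complex
  assumes "cmod e \<le> 1"
  shows "cmod (exp e - 1) \<le> 3 * cmod e"
proof -
  have "cmod (exp e - 1) \<le> exp \<bar>Re e\<bar> * cmod e"
    using Taylor_exp[of e 0] by simp
  also have "\<dots> \<le> 3 * cmod e"
  proof (rule mult_right_mono)
    have "\<bar>Re e\<bar> \<le> 1" using assms abs_Re_le_cmod order_trans by blast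
    then have "exp \<bar>Re e\<bar> \<le> exp 1" by simp
    then show "exp \<bar>Re e\<bar> \<le> 3" using exp_le by linarith
  qed simp
  finally show ?thesis .
qed

text \<open>By \<open>u v - 1 = (u - 1) v + (v - 1)\<close>, deviations from 1 written as
  \<open>U - 1\<close> and \<open>V - 1\<close> combine like real factors; powers then follow by
  induction.\<close>

lemma norm_mult_minus_1_le:
  fixes u v :: complex
  assumes "cmod (u - 1) \<le> U - 1" "cmod (v - 1) \<le> V - 1"
  shows "cmod (u * v - 1) \<le> U * V - 1"
proof -
  have U: "U \<ge> 1" using assms(1) norm_ge_zero[of "u - 1"] by linarith
  have v: "cmod v \<le> V" using assms(2) norm_triangle_ineq[of "v - 1" 1] by simp
  have "u * v - 1 = (u - 1) * v + (v - 1)" by (simp add: algebra_simps)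
  then have "cmod (u * v - 1) \<le> cmod (u - 1) * cmod v + cmod (v - 1)"
    by (metis norm_mult norm_triangle_ineq)
  also have "\<dots> \<le> (U - 1) * V + (V - 1)"
    using assms v U by (intro add_mono mult_mono) auto
  finally show ?thesis by (simp add: algebra_simps)
qed

lemma norm_power_minus_1_le:
  fixes u :: complex
  assumes "cmod (u - 1) \<le> \<delta>"
  shows "cmod (u ^ n - 1) \<le> (1 + \<delta>) ^ n - 1"
proof (induction n)
  case (Suc n)
  then show ?case using norm_mult_minus_1_le[of u "1 + \<delta>" "u ^ n" "(1 + \<delta>) ^ n"] assms by simp
qed simp

text \<open>The cost of rounding \<open>\<alpha>\<close> and \<open>\<beta>\<close>. Each factor has
  relative error at most \<open>\<delta> = D / m\<close>, so the monomial has relative error at most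
  \<open>(1 + \<delta>)^t - 1 <= exp (t \<delta>) - 1 <= 2 t \<delta>\<close> when
  \<open>t \<delta> <= 1\<close>.\<close>

lemma monomial_perturbation:
  fixes \<alpha> \<beta> a b :: complex
  assumes D: "cmod (\<alpha> - a) \<le> D" "cmod (\<beta> - b) \<le> D" and m: "m \<le> cmod \<alpha>" "m \<le> cmod \<beta>" "0 < m"
    and small: "real t * (D / m) \<le> 1" and pq: "p + q \<le> t"
  shows "cmod (\<alpha> ^ p * \<beta> ^ q - a ^ p * b ^ q) \<le> cmod (\<alpha> ^ p * \<beta> ^ q) * (2 * (real t * (D / m)))"
proof -
  define \<delta> where "\<delta> = D / m"
  have D0: "D \<ge> 0" using D(1) norm_ge_zero order_trans by blast
  have \<delta>0: "\<delta> \<ge> 0" using D0 m(3) by (simp add: \<delta>_def)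
  have quot: "cmod (c / \<gamma> - 1) \<le> \<delta>" if "cmod (\<gamma> - c) \<le> D" "m \<le> cmod \<gamma>" for c \<gamma>
  proof -
    have "\<gamma> \<noteq> 0" using that(2) m(3) by auto
    then have "c / \<gamma> - 1 = (c - \<gamma>) / \<gamma>" by (simp add: field_simps)
    then have "cmod (c / \<gamma> - 1) = cmod (\<gamma> - c) / cmod \<gamma>" by (simp add: norm_divide norm_minus_commute)
    also have "\<dots> \<le> D / m" using that m(3) D0 by (intro frac_le) auto
    finally show ?thesis by (simp add: \<delta>_def)
  qed
  have T: "0 \<le> real t * \<delta>" "real t * \<delta> \<le> 1"
    using \<delta>0 small[folded \<delta>_def] by simp_all
  have nz: "\<alpha> \<noteq> 0" "\<beta> \<noteq> 0" using m by auto
  have "cmod ((a / \<alpha>) ^ p * (b / \<beta>) ^ q - 1) \<le> (1 + \<delta>) ^ p * (1 + \<delta>) ^ q - 1"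
    by (intro norm_mult_minus_1_le norm_power_minus_1_le quot D m)
  also have "(1 + \<delta>) ^ p * (1 + \<delta>) ^ q = (1 + \<delta>) ^ (p + q)" by (simp add: power_add)
  also have "\<dots> \<le> (1 + \<delta>) ^ t" using \<delta>0 pq by (intro power_increasing) auto
  also have "\<dots> \<le> exp \<delta> ^ t" using \<delta>0 by (intro power_mono exp_ge_add_one_self) auto
  also have "\<dots> = exp (real t * \<delta>)" by (simp add: exp_of_nat_mult)
  also have "\<dots> \<le> 1 + real t * \<delta> + (real t * \<delta>)\<^sup>2" using T by (intro exp_bound)
  also have "(real t * \<delta>)\<^sup>2 \<le> real t * \<delta> * 1"
    unfolding power2_eq_square using T by (intro mult_left_mono)
  finally have main: "cmod ((a / \<alpha>) ^ p * (b / \<beta>) ^ q - 1) \<le> 2 * (real t * \<delta>)" by (simp add: algebra_simps)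
  have "a ^ p * b ^ q - \<alpha> ^ p * \<beta> ^ q = \<alpha> ^ p * \<beta> ^ q * ((a / \<alpha>) ^ p * (b / \<beta>) ^ q - 1)"
    using nz by (simp add: power_divide field_simps)
  then have "cmod (\<alpha> ^ p * \<beta> ^ q - a ^ p * b ^ q) = cmod (\<alpha> ^ p * \<beta> ^ q) * cmod ((a / \<alpha>) ^ p * (b / \<beta>) ^ q - 1)"
    by (metis norm_minus_commute norm_mult)
  also have "\<dots> \<le> cmod (\<alpha> ^ p * \<beta> ^ q) * (2 * (real t * \<delta>))" by (intro mult_left_mono main) auto
  finally show ?thesis by (simp add: \<delta>_def)
qed

text \<open>With \<open>\<alpha> ^ s = x\<close> and \<open>\<beta> ^ t = y\<close>, the absolute value of \<open>\<alpha> ^ p * \<beta> ^ (s - p)\<close> sweeps from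
  below \<open>\<bar>y\<bar>\<close> to \<open>\<bar>x\<bar>\<close> in small steps as \<open>p\<close> runs through the even numbers; the exponent of \<open>\<beta>\<close>
  is then odd, so that the choice of the branch of the \<open>t\<close>-th root, \<open>t\<close> a power of 2,
  moves the argument in steps of \<open>2 * pi / t\<close>.\<close>

lemma monomial_root_approximation:
  fixes x y z :: complex and r :: nat
  assumes r: "r \<ge> 1" and t: "t = 2 ^ r" and s: "Suc s = t"
    and xyz: "1 < cmod y" "cmod y \<le> cmod z" "cmod z \<le> cmod x"
  obtains \<alpha> \<beta> e :: complex and p q :: nat
  where "\<alpha> ^ s = x" "\<beta> ^ t = y" "cmod \<alpha> = exp (ln (cmod x) / s)" "cmod \<beta> = exp (ln (cmod y) / t)"
    "p + q = s" "\<alpha> ^ p * \<beta> ^ q = z * exp e"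
    "cmod e \<le> 2 * (ln (cmod x) / s - ln (cmod y) / t) + 2 * pi / t"
proof -
  define X Y Z where "X = Ln x" and "Y = Ln y" and "Z = Ln z"
  have nz: "x \<noteq> 0" "y \<noteq> 0" "z \<noteq> 0" using xyz by auto
  have expL: "exp X = x" "exp Y = y" "exp Z = z" using nz by (simp_all add: X_def Y_def Z_def)
  have Re: "Re X = ln (cmod x)" "Re Y = ln (cmod y)" "Re Z = ln (cmod z)"
    using nz by (simp_all add: X_def Y_def Z_def)
  have ln: "0 < Re Y" "Re Y \<le> Re Z" "Re Z \<le> Re X" using xyz nz by (simp_all add: Re)
  have evt: "even t" using r t by simp
  have "t \<ge> 2" using r t by (metis one_le_numeral power_increasing power_one_right)
  with s evt have s1: "s \<ge> 1" "odd s" "real t > 0" "real s > 0" "real t = real s + 1" by auto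
  define d where "d = Re X / s - Re Y / t"
  have d0: "d \<ge> 0"
  proof -
    have "Re Y / t \<le> Re X / s" using ln s1 by (intro frac_le) auto
    then show ?thesis by (simp add: d_def)
  qed
  \<comment> \<open>\<open>g j\<close> is the logarithm of the absolute value of
    \<open>\<alpha>^(2 j) * \<beta>^(s - 2 j)\<close>.\<close>
  define g where "g = (\<lambda>j::nat. real (2 * j) * (Re X / s) + (real s - real (2 * j)) * (Re Y / t))"
  have g: "g j = real s * (Re Y / t) + real j * (2 * d)" for j
    by (simp add: g_def d_def algebra_simps)
  obtain m where m: "s = 2 * m + 1" using s1(2) by (auto elim: oddE)
  have "\<exists>j\<le>m. g j \<le> Re Z \<and> Re Z \<le> g j + 2 * d"
  proof (rule discrete_intermediate_value)
    have "real s * (Re Y / t) \<le> Re Y" using ln s1 by (simp add: field_simps)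
    then show "g 0 \<le> Re Z" using ln by (simp add: g)
    show "g (Suc j) \<le> g j + 2 * d" for j by (simp add: g algebra_simps)
    \<comment> \<open>As \<open>s = 2 m + 1\<close>, the largest even exponent of
      \<open>\<alpha>\<close> stops one short of \<open>s\<close>, that is, half a step below
      \<open>Re X\<close>.\<close>
    have "g m + d = Re X"
    proof -
      have "g m + d = real s * (Re Y / t) + real s * d" by (simp add: g m algebra_simps)
      then show ?thesis using s1 by (simp add: d_def algebra_simps)
    qed
    then show "Re Z \<le> g m + 2 * d" using ln d0 by simp
  qed
  then obtain j where j: "j \<le> m" "g j \<le> Re Z" "Re Z \<le> g j + 2 * d" by blast
  define p q where "p = 2 * j" and "q = s - p"
  have pq: "p + q = s" "odd q" "real q = real s - real p" using j(1) m by (auto simp: p_def q_def)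
  \<comment> \<open>The missing argument in units of \<open>2 pi / t\<close>; rounding it to the
    integer \<open>w\<close> costs at most one unit.\<close>
  define \<rho> where "\<rho> = (Im Z - real p * (Im X / s) - real q * (Im Y / t)) * t / (2 * pi)"
  define w where "w = \<lfloor>\<rho>\<rfloor>"
  \<comment> \<open>The odd \<open>q\<close> is invertible modulo the power of two \<open>t\<close>,
    so a branch \<open>l\<close> exists with \<open>q l\<close> congruent to
    \<open>w\<close>.\<close>
  have "coprime (int q) (int t)" using pq(2) t by simp
  then obtain u v where uv: "u * int q + v * int t = 1"
    using bezout_int[of "int q" "int t"] by (auto simp: coprime_iff_gcd_eq_1)
  define l where "l = u * w"
  have ql: "int q * l = w - int t * (v * w)"
  proof -
    have "int q * l = (u * int q) * w" by (simp add: l_def)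
    also have "u * int q = 1 - v * int t" using uv by simp
    finally show ?thesis by (simp add: algebra_simps)
  qed
  define \<alpha> \<beta> where "\<alpha> = exp (X / of_nat s)" and "\<beta> = exp ((Y + 2 * of_int l * of_real pi * \<i>) / of_nat t)"
  define e where "e = of_nat p * (X / of_nat s) + of_nat q * (Y / of_nat t) + 2 * of_int w * of_real pi * \<i> / of_nat t - Z"
  have per: "exp (2 * of_int i * of_real pi * \<i>) = 1" for i :: int
    using exp_integer_2pi[of "of_int i"] by simp
  show thesis
  proof (rule that)
    show "\<alpha> ^ s = x"
      using s1 exp_of_nat_mult[of s "X / of_nat s"] by (simp add: \<alpha>_def expL)
    have "\<beta> ^ t = exp (Y + 2 * of_int l * of_real pi * \<i>)"
      using s1 exp_of_nat_mult[of t "(Y + 2 * of_int l * of_real pi * \<i>) / of_nat t"] by (simp add: \<beta>_def)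
    then show "\<beta> ^ t = y" by (simp add: exp_add expL per)
    show "cmod \<alpha> = exp (ln (cmod x) / s)" by (simp add: \<alpha>_def Re)
    show "cmod \<beta> = exp (ln (cmod y) / t)" by (simp add: \<beta>_def Re)
    show "p + q = s" by (rule pq)
    have "\<alpha> ^ p * \<beta> ^ q = exp (of_nat p * (X / of_nat s) + of_nat q * ((Y + 2 * of_int l * of_real pi * \<i>) / of_nat t))"
      by (simp only: \<alpha>_def \<beta>_def exp_add exp_of_nat_mult)
    also have "of_nat p * (X / of_nat s) + of_nat q * ((Y + 2 * of_int l * of_real pi * \<i>) / of_nat t)
        = Z + e + 2 * of_int (- v * w) * of_real pi * \<i>"
    proof -
      have "(of_nat q * of_int l :: complex) = of_int (int q * l)" by simp
      also have "\<dots> = of_int w - of_nat t * of_int (v * w)" by (simp add: ql)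
      finally have "(of_nat q * of_int l :: complex) / of_nat t = of_int w / of_nat t - of_int (v * w)"
        using s1 by (simp add: field_simps)
      note A = this
      have B: "of_nat q * ((Y + 2 * of_int l * of_real pi * \<i>) / of_nat t)
        = of_nat q * (Y / of_nat t) + 2 * (of_nat q * of_int l / of_nat t) * of_real pi * \<i>"
        by (simp add: field_simps add_divide_distrib)
      show ?thesis unfolding A B e_def by (simp add: algebra_simps)
    qed
    also have "exp (Z + e + 2 * of_int (- v * w) * of_real pi * \<i>) = z * exp e"
      by (simp only: exp_add per expL mult_1_right)
    finally show "\<alpha> ^ p * \<beta> ^ q = z * exp e" .
    have "Re e = g j - Re Z" by (simp add: e_def g_def p_def pq(3))
    then have "\<bar>Re e\<bar> \<le> 2 * d" using j by linarith
    moreover have "2 * pi / t * \<rho> = Im Z - real p * (Im X / s) - real q * (Im Y / t)"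
      using s1(3) by (simp add: \<rho>_def)
    then have "Im e = 2 * pi / t * (of_int w - \<rho>)"
      by (simp add: e_def algebra_simps diff_divide_distrib)
    then have "\<bar>Im e\<bar> = 2 * pi / t * \<bar>of_int w - \<rho>\<bar>" by (simp add: abs_mult)
    moreover have "2 * pi / t * \<bar>of_int w - \<rho>\<bar> \<le> 2 * pi / t * 1"
      unfolding w_def by (intro mult_left_mono) (linarith, simp)
    ultimately show "cmod e \<le> 2 * (ln (cmod x) / s - ln (cmod y) / t) + 2 * pi / t"
      using cmod_le[of e] unfolding d_def Re by linarith
  qed
qed

section \<open>From sorted triples to vectors of length \<open>n\<close>\<close>

text \<open>Dependence in three coordinates, with the condition that they be nonzero left to
  \<open>approx_dep\<close>.\<close>

definition dep_triple :: "complex \<Rightarrow> complex \<Rightarrow> complex \<Rightarrow> bool" where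
  "dep_triple v1 v2 v3 \<longleftrightarrow> (\<exists>k1 k2 k3 :: int. (k1 \<noteq> 0 \<or> k2 \<noteq> 0 \<or> k3 \<noteq> 0) \<and>
     v1 powi k1 * v2 powi k2 * v3 powi k3 = 1)"

definition approx_dep :: "complex set \<Rightarrow> real \<Rightarrow> complex \<Rightarrow> complex \<Rightarrow> complex \<Rightarrow> bool" where
  "approx_dep \<Lambda> \<epsilon> x y z \<longleftrightarrow> (\<exists>v1\<in>\<Lambda>-{0}. \<exists>v2\<in>\<Lambda>-{0}. \<exists>v3\<in>\<Lambda>-{0}. dep_triple v1 v2 v3 \<and>
     cmod (x - v1) \<le> \<epsilon> \<and> cmod (y - v2) \<le> \<epsilon> \<and> cmod (z - v3) \<le> \<epsilon>)"

text \<open>The two transpositions generate all permutations of the triple, which allows sorting by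
  absolute value.\<close>

lemma dep_triple_swap: "dep_triple v1 v2 v3 \<Longrightarrow> dep_triple v2 v1 v3" "dep_triple v1 v2 v3 \<Longrightarrow> dep_triple v1 v3 v2"
  unfolding dep_triple_def by (metis mult.commute, metis mult.commute mult.left_commute)

lemma approx_dep_swap: "approx_dep \<Lambda> \<epsilon> x y z \<Longrightarrow> approx_dep \<Lambda> \<epsilon> y x z"
    "approx_dep \<Lambda> \<epsilon> x y z \<Longrightarrow> approx_dep \<Lambda> \<epsilon> x z y"
  unfolding approx_dep_def using dep_triple_swap by blast+

lemma power_mem:
  assumes "1 \<in> \<Lambda>" "\<And>x y. x \<in> \<Lambda> \<Longrightarrow> y \<in> \<Lambda> \<Longrightarrow> x * y \<in> \<Lambda>" "a \<in> \<Lambda>"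
  shows "(a::complex) ^ n \<in> \<Lambda>"
  using assms by (induction n) auto

lemma ex_power2_between:
  fixes r :: real
  assumes "r > 1"
  obtains k :: nat where "k \<ge> 1" "r \<le> 2 ^ k" "2 ^ k \<le> 2 * r"
proof -
  define k where "k = (LEAST k::nat. r \<le> 2 ^ k)"
  have ex: "\<exists>k::nat. r \<le> 2 ^ k"
    using real_arch_pow[of 2 r] less_imp_le by auto
  then have k: "r \<le> 2 ^ k" unfolding k_def by (rule LeastI_ex)
  then have "k \<noteq> 0" using assms by (metis not_le power_0)
  then obtain j where j: "k = Suc j" using not0_implies_Suc by blast
  have "\<not> r \<le> 2 ^ j" using not_less_Least[of j "\<lambda>k. r \<le> 2 ^ k"] j unfolding k_def by simp
  then show thesis using k j by (intro that[of k]) auto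
qed

text \<open>Here \<open>u\<close> stands for \<open>(ln H)^(1/4)\<close>, so the target error is of
  order \<open>H / u^2\<close>. With \<open>t\<close> between \<open>u^3\<close> and
  \<open>2 u^3\<close>, the monomial misses \<open>z\<close> by a relative error of order
  \<open>u^(-2)\<close>. The roots are at least \<open>exp (u / 4)\<close>, so rounding them to
  \<open>\<Lambda>\<close> costs no more than that order.\<close>

lemma approx_dep_sorted:
  fixes \<Lambda> :: "complex set" and x y z :: complex and u D :: real
  assumes \<Lambda>: "1 \<in> \<Lambda>" "\<And>x y. x \<in> \<Lambda> \<Longrightarrow> y \<in> \<Lambda> \<Longrightarrow> x * y \<in> \<Lambda>"
    and D: "D > 0" "\<And>z. \<exists>w\<in>\<Lambda>. w \<noteq> 0 \<and> cmod (z - w) \<le> D"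
    and u: "u \<ge> 4" "6400000 * D \<le> u\<^sup>2"
    and xyz: "exp (u ^ 4) / u\<^sup>2 \<le> cmod y" "cmod y \<le> cmod z" "cmod z \<le> cmod x" "cmod x \<le> exp (u ^ 4)"
  shows "approx_dep \<Lambda> ((48 + 8 * (6400000 * D)) * (exp (u ^ 4) / u\<^sup>2)) x y z"
proof -
  define H where "H = exp (u ^ 4)"
  define A where "A = 6400000 * D"
  have A0: "A > 0" using D by (simp add: A_def)
  have u2: "0 < u\<^sup>2" "16 \<le> u\<^sup>2" using u power_mono[of 4 u 2] by auto
  have u3: "u ^ 3 > 1" using u by (intro one_less_power) auto
  obtain r where r: "r \<ge> 1" "u ^ 3 \<le> 2 ^ r" "2 ^ r \<le> 2 * u ^ 3"
    using ex_power2_between[OF u3] .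
  define t s :: nat where "t = 2 ^ r" and "s = t - 1"
  have t2: "t \<ge> 2" using r(1) unfolding t_def by (metis one_le_numeral power_increasing power_one_right)
  have ts: "Suc s = t" "real s = real t - 1" using t2 by (auto simp: s_def)
  have tu: "u ^ 3 \<le> real t" "real t \<le> 2 * u ^ 3" using r by (simp_all add: t_def)
  have tp: "real t > 0" "real s > 0" "real t \<le> 2 * real s" using t2 ts(2) by auto
  have H0: "0 < exp (u ^ 4) / u\<^sup>2" using u2 by simp
  then have y0: "0 < cmod y" using xyz(1) by linarith
  have lnu: "ln u \<le> u" using ln_le_minus_one[of u] u by simp
  have "ln (exp (u ^ 4) / u\<^sup>2) = u ^ 4 - 2 * ln u" using u by (simp add: ln_div ln_realpow)
  moreover have "ln (exp (u ^ 4) / u\<^sup>2) \<le> ln (cmod y)"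
    using ln_le_cancel_iff[OF H0 y0] xyz(1) by blast
  ultimately have lny: "u ^ 4 - 2 * u \<le> ln (cmod y)" using lnu by linarith
  have lnx: "ln (cmod x) \<le> u ^ 4"
  proof -
    have "ln (cmod x) \<le> ln (exp (u ^ 4))" using xyz y0 by (subst ln_le_cancel_iff) auto
    then show ?thesis by simp
  qed
  have lnyx: "ln (cmod y) \<le> ln (cmod x)" using xyz y0 by (subst ln_le_cancel_iff) auto
  have u4: "4 * u \<le> u ^ 4"
  proof -
    have "1 * (4 * u) \<le> u\<^sup>2 * (u * u)" using u u2 by (intro mult_mono) auto
    then show ?thesis by (simp add: power2_eq_square power4_eq_xxxx mult.assoc)
  qed
  then have lny2: "u ^ 4 / 2 \<le> ln (cmod y)" using lny by linarith
  then have y1: "1 < cmod y" using u4 u y0 by (smt (verit) ln_le_zero_iff half_gt_zero_iff)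
  obtain \<alpha> \<beta> e p q where ab: "\<alpha> ^ s = x" "\<beta> ^ t = y" "cmod \<alpha> = exp (ln (cmod x) / s)"
    "cmod \<beta> = exp (ln (cmod y) / t)" "p + q = s" "\<alpha> ^ p * \<beta> ^ q = z * exp e"
    "cmod e \<le> 2 * (ln (cmod x) / s - ln (cmod y) / t) + 2 * pi / t"
    using monomial_root_approximation[OF r(1) t_def ts(1) y1 xyz(2,3)] .
  \<comment> \<open>The difference between \<open>s\<close> and \<open>t\<close> and the gap between
    \<open>ln (cmod y)\<close> and \<open>u^4\<close> contribute \<open>2 / u^2\<close> each,
    doubled by the even steps; the argument contributes \<open>8 / u^2\<close>.\<close>
  have e: "cmod e \<le> 16 / u\<^sup>2"
  proof -
    have inv_t: "1 / real t \<le> 1 / u ^ 3" using tu(1) u by (intro frac_le) auto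
    have "ln (cmod x) / s \<le> u ^ 4 / s" using lnx tp by (intro divide_right_mono) auto
    also have "u ^ 4 / s = u ^ 4 / t + u ^ 4 / (real s * real t)" using tp by (simp add: field_simps) (simp add: ts(2) algebra_simps)
    also have "u ^ 4 / (real s * real t) \<le> u ^ 4 / ((real t / 2) * real t)"
      using tp by (intro divide_left_mono mult_right_mono mult_pos_pos) auto
    also have "\<dots> = 2 * u ^ 4 * (1 / real t) * (1 / real t)" by simp
    also have "\<dots> \<le> 2 * u ^ 4 * (1 / u ^ 3) * (1 / u ^ 3)"
      using inv_t tp u by (intro mult_mono) auto
    also have "\<dots> = 2 / u\<^sup>2" using u by (simp add: field_simps power2_eq_square eval_nat_numeral)
    finally have 1: "ln (cmod x) / s \<le> u ^ 4 / t + 2 / u\<^sup>2" by simp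
    have "ln (cmod y) / t \<ge> (u ^ 4 - 2 * u) / t" using lny tp by (intro divide_right_mono) auto
    then have 2: "ln (cmod y) / t \<ge> u ^ 4 / t - 2 * u * (1 / t)" by (simp add: diff_divide_distrib)
    have "2 * u * (1 / t) \<le> 2 * u * (1 / u ^ 3)" using inv_t u by (intro mult_left_mono) auto
    also have "\<dots> = 2 / u\<^sup>2" using u by (simp add: field_simps power2_eq_square eval_nat_numeral)
    finally have 3: "2 * u * (1 / t) \<le> 2 / u\<^sup>2" .
    have "2 * pi * (1 / t) \<le> 8 * (1 / u ^ 3)" using inv_t pi_less_4 by (intro mult_mono) auto
    also have "\<dots> \<le> 8 * (1 / u\<^sup>2)" using u by (intro mult_left_mono frac_le power_increasing) auto
    finally have 4: "2 * pi / t \<le> 8 / u\<^sup>2" by simp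
    have "ln (cmod x) / s - ln (cmod y) / t \<le> 2 / u\<^sup>2 + 2 / u\<^sup>2"
      using diff_mono[OF 1 2] 3 by simp
    then have "cmod e \<le> 2 * (2 / u\<^sup>2 + 2 / u\<^sup>2) + 8 / u\<^sup>2"
      using 4 by (intro order_trans[OF ab(7)] add_mono mult_left_mono) auto
    also have "\<dots> = 16 / u\<^sup>2" by simp
    finally show ?thesis .
  qed
  have "16 / u\<^sup>2 \<le> 1" using u2 by simp
  then have e1: "cmod e \<le> 1" using e by linarith
  define m where "m = exp (u / 4)"
  have m0: "m > 0" by (simp add: m_def)
  have u4t: "u / 4 \<le> ln (cmod y) / t"
  proof -
    have "u / 4 * real t \<le> u / 4 * (2 * u ^ 3)" using tu u by (intro mult_left_mono) auto
    also have "\<dots> = u ^ 4 / 2" by (simp add: eval_nat_numeral)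
    finally show ?thesis using lny2 tp by (simp add: pos_le_divide_eq)
  qed
  have "ln (cmod y) / t \<le> ln (cmod x) / s"
    using lnyx tp ts(2) ln_gt_zero[OF y1] by (intro frac_le) auto
  with u4t have "u / 4 \<le> ln (cmod x) / s" by (rule order_trans)
  then have m: "m \<le> cmod \<alpha>" "m \<le> cmod \<beta>"
    unfolding m_def ab(3,4) exp_le_cancel_iff using u4t by blast+
  \<comment> \<open>The constant is \<open>2 * 20^5 = 6400000\<close>, from
    \<open>t <= 2 u^3\<close> and \<open>exp (u / 4) = exp (u / 20)^5 >= (u / 20)^5\<close>.\<close>
  have tD: "real t * (D / m) \<le> A / u\<^sup>2"
  proof -
    have "u / 20 \<le> exp (u / 20)" using exp_ge_add_one_self[of "u / 20"] by linarith
    then have "(u / 20) ^ 5 \<le> exp (u / 20) ^ 5" using u by (intro power_mono) auto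
    also have "\<dots> = m" by (simp add: m_def flip: exp_of_nat_mult)
    finally have m5: "(u / 20) ^ 5 \<le> m" .
    have "real t * (D / m) \<le> (2 * u ^ 3) * (D / (u / 20) ^ 5)"
      using tu m5 D u m0 by (intro mult_mono divide_left_mono mult_pos_pos) auto
    also have "\<dots> = A / u\<^sup>2" using u by (simp add: A_def field_simps power2_eq_square eval_nat_numeral)
    finally show ?thesis .
  qed
  have "A / u\<^sup>2 \<le> 1" using u(2) u2 by (simp add: A_def)
  then have tD1: "real t * (D / m) \<le> 1" using tD by linarith
  obtain a where a: "a \<in> \<Lambda>" "a \<noteq> 0" "cmod (\<alpha> - a) \<le> D" using D(2) by blast
  obtain b where b: "b \<in> \<Lambda>" "b \<noteq> 0" "cmod (\<beta> - b) \<le> D" using D(2) by blast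
  have pert: "cmod (\<alpha> ^ i * \<beta> ^ j - a ^ i * b ^ j) \<le> cmod (\<alpha> ^ i * \<beta> ^ j) * (2 * (A / u\<^sup>2))"
    if "i + j \<le> t" for i j
  proof -
    have "cmod (\<alpha> ^ i * \<beta> ^ j - a ^ i * b ^ j) \<le> cmod (\<alpha> ^ i * \<beta> ^ j) * (2 * (real t * (D / m)))"
      by (rule monomial_perturbation[OF a(3) b(3) m m0 tD1 that])
    also have "\<dots> \<le> cmod (\<alpha> ^ i * \<beta> ^ j) * (2 * (A / u\<^sup>2))" using tD by (intro mult_left_mono) auto
    finally show ?thesis .
  qed
  \<comment> \<open>48 is \<open>3 * 16\<close>, from the estimate for \<open>exp e - 1\<close>; 8
    is \<open>4 * 2\<close>, from \<open>cmod (exp e) <= 4\<close> and the perturbation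
    bound.\<close>
  define \<epsilon> where "\<epsilon> = (48 + 8 * A) * (H / u\<^sup>2)"
  have H0: "H > 0" by (simp add: H_def)
  have nH: "cmod x \<le> H" "cmod y \<le> H" "cmod z \<le> H" using xyz by (auto simp: H_def)
  have small: "w * (2 * (A / u\<^sup>2)) \<le> \<epsilon>" if "w \<le> H" for w
  proof -
    have "w * (2 * (A / u\<^sup>2)) \<le> H * (2 * (A / u\<^sup>2))" using that A0 by (intro mult_right_mono) auto
    also have "\<dots> = 2 * A * (H / u\<^sup>2)" by simp
    also have "\<dots> \<le> \<epsilon>" unfolding \<epsilon>_def using A0 H0 by (intro mult_right_mono) auto
    finally show ?thesis .
  qed
  have E1: "cmod (x - a ^ s) \<le> \<epsilon>"
    using pert[of s 0] small[OF nH(1)] ts(1) by (simp add: ab(1))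
  have E2: "cmod (y - b ^ t) \<le> \<epsilon>"
    using pert[of 0 t] small[OF nH(2)] by (simp add: ab(2))
  have exp3: "cmod (exp e - 1) \<le> 3 * (16 / u\<^sup>2)" using norm_exp_minus_1_le[OF e1] e by linarith
  have E3: "cmod (z - a ^ p * b ^ q) \<le> \<epsilon>"
  proof -
    have "z - z * exp e = - (z * (exp e - 1))" by (simp add: algebra_simps)
    then have "cmod (z - z * exp e) = cmod z * cmod (exp e - 1)" by (metis norm_minus_cancel norm_mult)
    also have "\<dots> \<le> H * (3 * (16 / u\<^sup>2))" using nH exp3 H0 by (intro mult_mono) auto
    finally have f1: "cmod (z - z * exp e) \<le> H * (3 * (16 / u\<^sup>2))" .
    have "cmod (exp e) \<le> 4"
      using norm_exp_minus_1_le[OF e1] e1 norm_triangle_ineq[of "exp e - 1" 1] by simp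
    then have "cmod (z * exp e) \<le> H * 4" unfolding norm_mult using nH H0 by (intro mult_mono) auto
    then have "cmod (z * exp e) * (2 * (A / u\<^sup>2)) \<le> H * 4 * (2 * (A / u\<^sup>2))" using A0 by (intro mult_right_mono) auto
    then have f2: "cmod (z * exp e - a ^ p * b ^ q) \<le> H * 4 * (2 * (A / u\<^sup>2))"
      using pert[of p q] ab(5) ts(1) unfolding ab(6) by simp
    have "cmod (z - a ^ p * b ^ q) \<le> cmod (z - z * exp e) + cmod (z * exp e - a ^ p * b ^ q)"
      using norm_triangle_ineq[of "z - z * exp e" "z * exp e - a ^ p * b ^ q"] by simp
    also have "\<dots> \<le> H * (3 * (16 / u\<^sup>2)) + H * 4 * (2 * (A / u\<^sup>2))" using f1 f2 by (rule add_mono)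
    also have "\<dots> = \<epsilon>" by (simp add: \<epsilon>_def algebra_simps add_divide_distrib)
    finally show ?thesis .
  qed
  have "dep_triple (a ^ s) (b ^ t) (a ^ p * b ^ q)"
  proof -
    \<comment> \<open>The relation is \<open>(a^s)^(p t) * (b^t)^(q s) = (a^p b^q)^(s t)\<close>;
      both sides equal \<open>c\<close>.\<close>
    define c where "c = a ^ (s * p * t) * b ^ (t * q * s)"
    have c0: "c \<noteq> 0" using a b by (simp add: c_def)
    have "(a ^ s) powi int (p * t) * (b ^ t) powi int (q * s) = c"
      by (simp only: c_def power_int_of_nat power_mult[symmetric] mult.assoc)
    moreover have "(a ^ p * b ^ q) powi (- int (s * t)) = inverse c"
      by (simp only: power_int_minus power_int_of_nat power_mult_distrib power_mult[symmetric] c_def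
          mult.commute mult.left_commute)
    moreover have "- int (s * t) \<noteq> 0" using tp by simp
    ultimately show ?thesis unfolding dep_triple_def using c0
      by (intro exI[of _ "int (p * t)"] exI[of _ "int (q * s)"] exI[of _ "- int (s * t)"]) simp
  qed
  moreover have "a ^ s \<in> \<Lambda> - {0}" "b ^ t \<in> \<Lambda> - {0}" "a ^ p * b ^ q \<in> \<Lambda> - {0}"
    using a(2) b(2) power_mem[OF \<Lambda> a(1)] power_mem[OF \<Lambda> b(1)] \<Lambda>(2) by auto
  ultimately have "approx_dep \<Lambda> \<epsilon> x y z" unfolding approx_dep_def using E1 E2 E3 by blast
  then show ?thesis by (simp only: \<epsilon>_def A_def H_def)
qed

lemma approx_dep_large:
  fixes \<Lambda> :: "complex set" and x y z :: complex and u D :: real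
  assumes \<Lambda>: "1 \<in> \<Lambda>" "\<And>x y. x \<in> \<Lambda> \<Longrightarrow> y \<in> \<Lambda> \<Longrightarrow> x * y \<in> \<Lambda>"
    and D: "D > 0" "\<And>z. \<exists>w\<in>\<Lambda>. w \<noteq> 0 \<and> cmod (z - w) \<le> D"
    and u: "u \<ge> 4" "6400000 * D \<le> u\<^sup>2"
    and lower: "exp (u ^ 4) / u\<^sup>2 \<le> cmod x" "exp (u ^ 4) / u\<^sup>2 \<le> cmod y" "exp (u ^ 4) / u\<^sup>2 \<le> cmod z"
    and upper: "cmod x \<le> exp (u ^ 4)" "cmod y \<le> exp (u ^ 4)" "cmod z \<le> exp (u ^ 4)"
  shows "approx_dep \<Lambda> ((48 + 8 * (6400000 * D)) * (exp (u ^ 4) / u\<^sup>2)) x y z"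
proof -
  define \<epsilon> where "\<epsilon> = (48 + 8 * (6400000 * D)) * (exp (u ^ 4) / u\<^sup>2)"
  have *: "approx_dep \<Lambda> \<epsilon> x y z" if "exp (u ^ 4) / u\<^sup>2 \<le> cmod y" "cmod y \<le> cmod z" "cmod z \<le> cmod x"
    "cmod x \<le> exp (u ^ 4)" for x y z
    unfolding \<epsilon>_def by (rule approx_dep_sorted[OF \<Lambda> D u that])
  consider "cmod y \<le> cmod z" "cmod z \<le> cmod x" | "cmod z \<le> cmod y" "cmod y \<le> cmod x"
    | "cmod x \<le> cmod z" "cmod z \<le> cmod y" | "cmod z \<le> cmod x" "cmod x \<le> cmod y"
    | "cmod y \<le> cmod x" "cmod x \<le> cmod z" | "cmod x \<le> cmod y" "cmod y \<le> cmod z"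
    by linarith
  then have "approx_dep \<Lambda> \<epsilon> x y z"
    using lower upper *[of y z x] *[of z y x] *[of x z y] *[of z x y] *[of y x z] *[of x y z]
    by cases (meson approx_dep_swap)+
  then show ?thesis by (simp only: \<epsilon>_def)
qed

text \<open>If some coordinate is smaller than \<open>\<eta>\<close>, replacing it by 1 is cheap and
  already makes the vector dependent. Otherwise the first three coordinates are approximated by a
  dependent triple. All other coordinates go to nearby points of \<open>\<Lambda>\<close> with
  exponent 0.\<close>

lemma mu_upper_large:
  fixes R \<Lambda> :: "complex set" and u D :: real
  assumes R: "\<Lambda> \<subseteq> R" and n: "n \<ge> 3"
    and \<Lambda>: "1 \<in> \<Lambda>" "\<And>x y. x \<in> \<Lambda> \<Longrightarrow> y \<in> \<Lambda> \<Longrightarrow> x * y \<in> \<Lambda>"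
    and D: "D > 0" "\<And>z. \<exists>w\<in>\<Lambda>. w \<noteq> 0 \<and> cmod (z - w) \<le> D"
    and u: "u \<ge> 4" "6400000 * D \<le> u\<^sup>2"
  shows "mu n (exp (u ^ 4)) R \<le> real n * ((48 + 8 * (6400000 * D)) * (exp (u ^ 4) / u\<^sup>2))"
proof (rule mu_upperI)
  define \<eta> where "\<eta> = exp (u ^ 4) / u\<^sup>2"
  define \<epsilon> where "\<epsilon> = (48 + 8 * (6400000 * D)) * \<eta>"
  have "u\<^sup>2 \<le> exp (u ^ 4)"
  proof -
    have "u\<^sup>2 \<le> u ^ 4" using u by (intro power_increasing) auto
    then show ?thesis using exp_ge_add_one_self[of "u ^ 4"] by linarith
  qed
  then have \<eta>: "\<eta> \<ge> 1" using u by (simp add: \<eta>_def)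
  have D\<epsilon>: "D \<le> \<epsilon>"
  proof -
    have "D * 1 \<le> (48 + 8 * (6400000 * D)) * \<eta>" using D(1) \<eta> by (intro mult_mono) auto
    then show ?thesis by (simp add: \<epsilon>_def)
  qed
  have \<eta>\<epsilon>: "\<eta> + 1 \<le> \<epsilon>"
  proof -
    have "2 * \<eta> \<le> (48 + 8 * (6400000 * D)) * \<eta>" using D(1) \<eta> by (intro mult_right_mono) auto
    then show ?thesis using \<eta> unfolding \<epsilon>_def by linarith
  qed
  show "0 \<le> exp (u ^ 4)" by simp
  fix x assume x: "x \<in> cspace n" "cnorm n x \<le> exp (u ^ 4)"
  have "\<exists>w. (\<forall>i<n. w i \<in> \<Lambda> \<and> w i \<noteq> 0 \<and> cmod (x i - w i) \<le> \<epsilon>) \<and>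
      (\<exists>k :: nat \<Rightarrow> int. (\<exists>i<n. k i \<noteq> 0) \<and> (\<Prod>i<n. w i powi k i) = 1)"
  proof (cases "\<exists>i<n. cmod (x i) < \<eta>")
    case True
    then obtain i0 where i0: "i0 < n" "cmod (x i0) < \<eta>" by blast
    obtain a where a: "\<And>z. a z \<in> \<Lambda> \<and> a z \<noteq> 0 \<and> cmod (z - a z) \<le> D" using D(2) by metis
    define w where "w = (\<lambda>i. if i = i0 then 1 else a (x i))"
    have "cmod (x i0 - 1) \<le> \<epsilon>" using norm_triangle_ineq4[of "x i0" 1] i0(2) \<eta>\<epsilon> by simp
    then have "\<forall>i<n. w i \<in> \<Lambda> \<and> w i \<noteq> 0 \<and> cmod (x i - w i) \<le> \<epsilon>"
      using a \<Lambda>(1) D\<epsilon> order_trans by (auto simp: w_def)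
    moreover have "(\<Prod>i<n. w i powi (if i = i0 then 1 else 0)) = 1"
      by (intro prod.neutral) (simp add: w_def)
    ultimately show ?thesis using i0(1)
      by (intro exI[of _ w] conjI exI[of _ "\<lambda>i. if i = i0 then 1 else 0"] exI[of _ i0]) auto
  next
    case False
    then have lower: "\<eta> \<le> cmod (x i)" if "i < n" for i using that by (meson not_le)
    have upper: "cmod (x i) \<le> exp (u ^ 4)" if "i < n" for i
      using cnorm_component[OF that, of x] x(2) by linarith
    have "approx_dep \<Lambda> \<epsilon> (x 0) (x 1) (x 2)"
      using n lower upper unfolding \<epsilon>_def \<eta>_def by (intro approx_dep_large[OF \<Lambda> D u]) auto
    then obtain v1 v2 v3 where v: "v1 \<in> \<Lambda>" "v1 \<noteq> 0" "v2 \<in> \<Lambda>" "v2 \<noteq> 0" "v3 \<in> \<Lambda>" "v3 \<noteq> 0"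
      "dep_triple v1 v2 v3" "cmod (x 0 - v1) \<le> \<epsilon>" "cmod (x 1 - v2) \<le> \<epsilon>" "cmod (x 2 - v3) \<le> \<epsilon>"
      unfolding approx_dep_def by auto
    obtain k1 k2 k3 where k: "k1 \<noteq> 0 \<or> k2 \<noteq> 0 \<or> k3 \<noteq> (0::int)" "v1 powi k1 * v2 powi k2 * v3 powi k3 = 1"
      using v(7) unfolding dep_triple_def by blast
    obtain a where a: "\<And>z. a z \<in> \<Lambda> \<and> a z \<noteq> 0 \<and> cmod (z - a z) \<le> D" using D(2) by metis
    define w where "w = (\<lambda>i. if i = 0 then v1 else if i = 1 then v2 else if i = 2 then v3 else a (x i))"
    define l where "l = (\<lambda>i::nat. if i = 0 then k1 else if i = 1 then k2 else if i = 2 then k3 else 0)"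
    have "w i \<in> \<Lambda> \<and> w i \<noteq> 0 \<and> cmod (x i - w i) \<le> \<epsilon>" for i
      using a[of "x i"] v D\<epsilon> by (auto simp: w_def)
    moreover have "(\<Prod>i<n. w i powi l i) = (\<Prod>i\<in>{0, 1, 2}. w i powi l i)"
      using n by (intro prod.mono_neutral_right) (auto simp: l_def)
    then have "(\<Prod>i<n. w i powi l i) = 1" using k(2) by (simp add: w_def l_def mult.assoc)
    moreover have "\<exists>i<n. l i \<noteq> 0"
    proof -
      have "l 0 \<noteq> 0 \<or> l 1 \<noteq> 0 \<or> l 2 \<noteq> 0" using k(1) by (simp add: l_def)
      moreover have "0 < n" "1 < n" "2 < n" using n by auto
      ultimately show ?thesis by blast
    qed
    ultimately show ?thesis by blast
  qed
  then obtain w k where w: "\<And>i. i < n \<Longrightarrow> w i \<in> \<Lambda> \<and> w i \<noteq> 0 \<and> cmod (x i - w i) \<le> \<epsilon>"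
    and k: "\<exists>i<n. k i \<noteq> (0::int)" "(\<Prod>i<n. w i powi k i) = 1" by blast
  define v where "v = restrict w {..<n}"
  have "(\<Prod>i<n. v i powi k i) = 1" using k(2) by (simp add: v_def)
  then have "v \<in> mult_dep_vectors n R"
    using w k(1) R by (auto simp: mult_dep_vectors_def mult_dependent_def cspace_def v_def)
  moreover have "cnorm n (\<lambda>i. x i - v i) \<le> real n * \<epsilon>"
  proof -
    have "cnorm n (\<lambda>i. x i - v i) \<le> (\<Sum>i<n. cmod (x i - v i))" by (rule cnorm_le_sum)
    also have "\<dots> \<le> (\<Sum>i<n. \<epsilon>)" using w by (intro sum_mono) (auto simp: v_def)
    finally show ?thesis by simp
  qed
  ultimately show "\<exists>v\<in>mult_dep_vectors n R. cnorm n (\<lambda>i. x i - v i)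
      \<le> real n * ((48 + 8 * (6400000 * D)) * (exp (u ^ 4) / u\<^sup>2))"
    unfolding \<epsilon>_def \<eta>_def by blast
qed

section \<open>The theorem\<close>

text \<open>Above the threshold \<open>T\<close>, \<open>mu_upper_large\<close> applies with
  \<open>u = (ln H)^(1/4)\<close>; below it, \<open>u\<close> is bounded and the trivial bound is of
  order \<open>H / u^2\<close>. The double logarithm enters through its positive lower bound
  \<open>\<kappa> = ln (ln 3)\<close>.\<close>

lemma mu_upper_log:
  fixes R \<Lambda> :: "complex set" and D :: real
  assumes R: "\<Lambda> \<subseteq> R" "1 \<in> \<Lambda>" "\<And>x y. x \<in> \<Lambda> \<Longrightarrow> y \<in> \<Lambda> \<Longrightarrow> x * y \<in> \<Lambda>"
    and D: "D > 0" "\<And>z. \<exists>w\<in>\<Lambda>. w \<noteq> 0 \<and> cmod (z - w) \<le> D"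
    and n: "n \<ge> 3"
  shows "\<exists>c>0. \<forall>H\<ge>3. mu n H R \<le> c * (H * (ln (ln H) / ln H powr (1/2)))"
proof -
  define T where "T = max 4 (sqrt (6400000 * D))"
  define K where "K = max (real n * (48 + 8 * (6400000 * D))) ((1 + real n) * T\<^sup>2)"
  define \<kappa> where "\<kappa> = ln (ln (3::real))"
  have T: "T \<ge> 4" "6400000 * D \<le> T\<^sup>2"
  proof -
    show "T \<ge> 4" by (simp add: T_def)
    have "(sqrt (6400000 * D))\<^sup>2 \<le> T\<^sup>2" using D(1) by (intro power_mono) (auto simp: T_def)
    then show "6400000 * D \<le> T\<^sup>2" using D(1) by simp
  qed
  have K0: "K > 0" using D(1) n by (simp add: K_def less_max_iff_disj)
  have "ln (3::real) > 1"
  proof -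
    have "exp 1 < (3::real)" using e_less_272 by simp
    then have "ln (exp 1) < ln (3::real)" by (subst ln_less_cancel_iff) auto
    then show ?thesis by simp
  qed
  then have \<kappa>: "\<kappa> > 0" by (simp add: \<kappa>_def)
  have R1: "1 \<in> R" using R by blast
  have "mu n H R \<le> K / \<kappa> * (H * (ln (ln H) / ln H powr (1/2)))" if H: "H \<ge> 3" for H
  proof -
    have lnH: "ln H \<ge> 1" using ln_ge_1[OF H] .
    define u where "u = ln H powr (1/4)"
    have u0: "u > 0" using lnH by (simp add: u_def)
    have u4: "u ^ 4 = ln H" "u\<^sup>2 = ln H powr (1/2)"
      using lnH by (simp_all add: u_def powr_powr flip: powr_realpow)
    have H4: "H = exp (u ^ 4)" using H by (simp add: u4)
    have Hu: "0 \<le> H / u\<^sup>2" using H by simp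
    have main: "mu n H R \<le> K * (H / u\<^sup>2)"
    proof (cases "u \<ge> T")
      case True
      have "T\<^sup>2 \<le> u\<^sup>2" using True T by (intro power_mono) auto
      then have uT: "4 \<le> u" "6400000 * D \<le> u\<^sup>2" using True T by linarith+
      have "mu n H R \<le> real n * ((48 + 8 * (6400000 * D)) * (H / u\<^sup>2))"
        unfolding H4 by (rule mu_upper_large[OF R(1) n R(2,3) D uT])
      also have "\<dots> = real n * (48 + 8 * (6400000 * D)) * (H / u\<^sup>2)" by simp
      also have "\<dots> \<le> K * (H / u\<^sup>2)" using Hu by (intro mult_right_mono) (simp_all add: K_def)
      finally show ?thesis .
    next
      case False
      have "mu n H R \<le> H + real n" using n H by (intro mu_le_trivial R1) auto
      also have "\<dots> \<le> (1 + real n) * H" using H mult_left_mono[of 1 H "real n"] by (simp add: algebra_simps)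
      also have "\<dots> \<le> (1 + real n) * (T\<^sup>2 * (H / u\<^sup>2))"
      proof (rule mult_left_mono)
        have "u\<^sup>2 \<le> T\<^sup>2" using False u0 by (intro power_mono) auto
        then have "u\<^sup>2 * (H / u\<^sup>2) \<le> T\<^sup>2 * (H / u\<^sup>2)" using Hu by (rule mult_right_mono)
        then show "H \<le> T\<^sup>2 * (H / u\<^sup>2)" using u0 by simp
      qed simp
      also have "\<dots> = (1 + real n) * T\<^sup>2 * (H / u\<^sup>2)" by simp
      also have "\<dots> \<le> K * (H / u\<^sup>2)" using Hu by (intro mult_right_mono) (simp_all add: K_def)
      finally show ?thesis .
    qed
    have \<kappa>H: "\<kappa> \<le> ln (ln H)"
    proof -
      have "ln 3 \<le> ln H" using H by simp
      then show ?thesis unfolding \<kappa>_def using \<open>ln 3 > 1\<close> by (subst ln_le_cancel_iff) auto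
    qed
    have "K * (H / u\<^sup>2) * 1 \<le> K * (H / u\<^sup>2) * (ln (ln H) / \<kappa>)"
    proof (rule mult_left_mono)
      show "1 \<le> ln (ln H) / \<kappa>" using \<kappa>H \<kappa> by simp
      show "0 \<le> K * (H / u\<^sup>2)" using K0 Hu by (intro mult_nonneg_nonneg) simp_all
    qed
    also have "\<dots> = K / \<kappa> * (H * (ln (ln H) / ln H powr (1/2)))" by (simp add: u4 mult_ac)
    finally show ?thesis using main by simp
  qed
  moreover have "K / \<kappa> > 0" using K0 \<kappa> by simp
  ultimately show ?thesis by blast
qed

theorem theorem1p8:
  shows "(\<forall>K. imaginary_quadratic_field K \<longrightarrow>
            (\<exists>c>0. \<forall>H>1. \<bar>H\<bar> \<le> c * mu 2 H (ring_of_integers K)) \<and>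
            (\<exists>c>0. \<forall>H>1. \<bar>mu 2 H (ring_of_integers K)\<bar> \<le> c * H)) \<and>
         (\<exists>C\<^sub>0 :: nat \<Rightarrow> real. computable_real_seq C\<^sub>0 \<and>
            (\<forall>K n. imaginary_quadratic_field K \<longrightarrow> n \<ge> 3 \<longrightarrow>
               (\<exists>c>0. \<forall>H\<ge>3. \<bar>H / ln H powr C\<^sub>0 n\<bar> \<le> c * mu n H (ring_of_integers K)) \<and>
               (\<exists>c>0. \<forall>H\<ge>3. \<bar>mu n H (ring_of_integers K)\<bar>
                                \<le> c * (H * (ln (ln H) / ln H powr (1/2))))))"
proof (intro conjI allI impI exI[of _ "\<lambda>n. 2 ^ (2 * n) :: real"])
  fix K assume K: "imaginary_quadratic_field K"
  let ?R = "ring_of_integers K"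
  obtain \<Lambda> D where R: "\<Lambda> \<subseteq> ?R" "1 \<in> \<Lambda>" using imaginary_quadratic_order[OF K] by metis
  then have R1: "1 \<in> ?R" by blast
  note norm = ring_of_integers_norm_square[OF K]
  have mu1: "1 \<le> mu 2 H ?R" if "H > 1" for H using that by (intro mu_ge_1 R1 norm) auto
  \<comment> \<open>For \<open>1 < H < 2\<close> the bound \<open>mu >= 1\<close> takes
    over.\<close>
  have "\<bar>H\<bar> \<le> 100 * mu 2 H ?R" if "H > 1" for H
    using mu_2_lower[OF R1 _ norm, of H] mu1[OF that] that by (cases "H \<ge> 2") auto
  then show "\<exists>c>0. \<forall>H>1. \<bar>H\<bar> \<le> c * mu 2 H ?R" by (intro exI[of _ 100]) auto
  \<comment> \<open>The trivial bound \<open>H + 2\<close> is at most \<open>3 H\<close> for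
    \<open>H > 1\<close>.\<close>
  have "\<bar>mu 2 H ?R\<bar> \<le> 3 * H" if "H > 1" for H
    using mu_le_trivial[OF R1, of 2 H] mu1[OF that] that by auto
  then show "\<exists>c>0. \<forall>H>1. \<bar>mu 2 H ?R\<bar> \<le> c * H" by (intro exI[of _ 3]) auto
next
  show "computable_real_seq (\<lambda>n. 2 ^ (2 * n))" by (rule computable_power2_double)
next
  fix K and n :: nat assume K: "imaginary_quadratic_field K" and n: "3 \<le> n"
  let ?R = "ring_of_integers K"
  obtain \<Lambda> D where R: "\<Lambda> \<subseteq> ?R" "1 \<in> \<Lambda>" "\<And>x y. x \<in> \<Lambda> \<Longrightarrow> y \<in> \<Lambda> \<Longrightarrow> x * y \<in> \<Lambda>"
    and D: "D > 0" "\<And>z. \<exists>w\<in>\<Lambda>. w \<noteq> 0 \<and> cmod (z - w) \<le> D" using imaginary_quadratic_order[OF K] by metis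
  have R1: "1 \<in> ?R" using R by blast
  note norm = ring_of_integers_norm_square[OF K]
  show "\<exists>c>0. \<forall>H\<ge>3. \<bar>H / ln H powr 2 ^ (2 * n)\<bar> \<le> c * mu n H ?R"
    using n by (intro mu_lower_log R1 norm) auto
  have "\<bar>mu n H ?R\<bar> = mu n H ?R" if "H \<ge> 3" for H
    using mu_ge_1[OF R1 _ _ norm, of n H] n that by simp
  then show "\<exists>c>0. \<forall>H\<ge>3. \<bar>mu n H ?R\<bar> \<le> c * (H * (ln (ln H) / ln H powr (1/2)))"
    using mu_upper_log[OF R D n] by simp
qed

end
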